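(* Let $g:\mathbb{N}\rightarrow\mathbb{N}$ be a subexponential function. Then there exists an increasing, submultiplicative function $f:\mathbb{N}\rightarrow \mathbb{N}$ such that $f\succeq g$ and $f$ is not equivalent to the growth function of any finitely generated associative algebra (over any field).
   Context: $\mathbb{N}=\{1,2,3,\dots\}$. A function $g:\mathbb{N}\to\mathbb{N}$ is subexponential if there is $\omega:\mathbb{N}\to\mathbb{R}$ with $\omega(n)\to 0$ as $n\to\infty$ and $g(n)\le 2^{n\omega(n)}$ for all $n$. A function $f:\mathbb{N}\to\mathbb{N}$ is increasing if $f(n)<f(n+1)$ for all $n$, and submultiplicative if $f(n+m)\le f(n)f(m)$ for all $n,m$. For functions $f,g:\mathbb{N}\to\mathbb{N}$: $f\preceq g$ (equivalently $g\succeq f$) means that there is a positive integer $C$ with $f(n)\le g(Cn)$ for all $n$; $f$ and $g$ are equivalent, $f\sim g$, if there are positive integers $C,D$ with $f(n)\le g(Cn)\le f(Dn)$ for all $n$. Growth functions: let $F$ be a field, $R$ a finitely generated associative $F$-algebra and $V\subseteq R$ a finite dimensional subspace generating $R$ as an algebra. The growth function of $R$ with respect to $V$ is $\gamma_{R,V}(n)=\dim_F V^n$, where $V^n$ denotes the span of all products of at most $n$ elements of $V$ (the empty product $1$ being included if $R$ is unital). A different choice of $V$ changes $\gamma_{R,V}$ only up to $\sim$, so the growth function of $R$ is regarded as defined up to $\sim$. *)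

theory Defs
  imports Complex_Main "Jordan_Normal_Form.Missing_VectorSpace"
begin

text \<open>
  The positive integers are the domain and codomain of all functions below. They are rendered by
  \<^typ>\<open>nat \<Rightarrow> nat\<close>, with the value at \<open>0\<close> ignored and positivity of the other values stated.
\<close>

definition positive_fun :: "(nat \<Rightarrow> nat) \<Rightarrow> bool" where
  "positive_fun f \<longleftrightarrow> (\<forall>n\<ge>1. f n \<ge> 1)"

definition subexponential :: "(nat \<Rightarrow> nat) \<Rightarrow> bool" where
  "subexponential g \<longleftrightarrow>
     (\<exists>\<omega> :: nat \<Rightarrow> real. \<omega> \<longlonglongrightarrow> 0 \<and> (\<forall>n\<ge>1. real (g n) \<le> 2 powr (real n * \<omega> n)))"

definition increasing :: "(nat \<Rightarrow> nat) \<Rightarrow> bool" where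
  "increasing f \<longleftrightarrow> (\<forall>n\<ge>1. f n < f (n + 1))"

definition submultiplicative :: "(nat \<Rightarrow> nat) \<Rightarrow> bool" where
  "submultiplicative f \<longleftrightarrow> (\<forall>n\<ge>1. \<forall>m\<ge>1. f (n + m) \<le> f n * f m)"

definition growth_le :: "(nat \<Rightarrow> nat) \<Rightarrow> (nat \<Rightarrow> nat) \<Rightarrow> bool" (infix \<open>\<preceq>\<close> 50) where
  "f \<preceq> g \<longleftrightarrow> (\<exists>C\<ge>1. \<forall>n\<ge>1. f n \<le> g (C * n))"

definition growth_equiv :: "(nat \<Rightarrow> nat) \<Rightarrow> (nat \<Rightarrow> nat) \<Rightarrow> bool" (infix \<open>\<approx>\<close> 50) where
  "f \<approx> g \<longleftrightarrow> (\<exists>C\<ge>1. \<exists>D\<ge>1. \<forall>n\<ge>1. f n \<le> g (C * n) \<and> g (C * n) \<le> f (D * n))"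

text \<open>
  Associative algebras over a field, possibly noncommutative and possibly without identity. (The
  library locale \<^locale>\<open>algebra\<close> is commutative and unital.) The field \<open>one\<close> of the
  record is not constrained; whether an algebra is unital is decided by the existence of an
  identity element.
\<close>

locale assoc_algebra = vectorspace K A for K and A (structure) +
  assumes alg_m_closed: "\<lbrakk>x \<in> carrier A; y \<in> carrier A\<rbrakk> \<Longrightarrow> x \<otimes> y \<in> carrier A"
    and alg_m_assoc: "\<lbrakk>x \<in> carrier A; y \<in> carrier A; z \<in> carrier A\<rbrakk>
          \<Longrightarrow> (x \<otimes> y) \<otimes> z = x \<otimes> (y \<otimes> z)"
    and alg_l_distr: "\<lbrakk>x \<in> carrier A; y \<in> carrier A; z \<in> carrier A\<rbrakk>
          \<Longrightarrow> (x \<oplus> y) \<otimes> z = (x \<otimes> z) \<oplus> (y \<otimes> z)"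
    and alg_r_distr: "\<lbrakk>x \<in> carrier A; y \<in> carrier A; z \<in> carrier A\<rbrakk>
          \<Longrightarrow> x \<otimes> (y \<oplus> z) = (x \<otimes> y) \<oplus> (x \<otimes> z)"
    and alg_smult_l: "\<lbrakk>a \<in> carrier K; x \<in> carrier A; y \<in> carrier A\<rbrakk>
          \<Longrightarrow> (a \<odot> x) \<otimes> y = a \<odot> (x \<otimes> y)"
    and alg_smult_r: "\<lbrakk>a \<in> carrier K; x \<in> carrier A; y \<in> carrier A\<rbrakk>
          \<Longrightarrow> x \<otimes> (a \<odot> y) = a \<odot> (x \<otimes> y)"

text \<open>The set of identity elements: a singleton if the algebra is unital, and empty otherwise.\<close>

definition identities :: "('k, 'a) module \<Rightarrow> 'a set" where
  "identities A = {e \<in> carrier A. \<forall>x\<in>carrier A. e \<otimes>\<^bsub>A\<^esub> x = x \<and> x \<otimes>\<^bsub>A\<^esub> e = x}"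

text \<open>A subalgebra of a unital algebra is required to contain its identity.\<close>

definition assoc_subalgebra :: "'k ring \<Rightarrow> ('k, 'a) module \<Rightarrow> 'a set \<Rightarrow> bool" where
  "assoc_subalgebra K A S \<longleftrightarrow> subspace K S A \<and> identities A \<subseteq> S \<and>
     (\<forall>x\<in>S. \<forall>y\<in>S. x \<otimes>\<^bsub>A\<^esub> y \<in> S)"

definition generates :: "'k ring \<Rightarrow> ('k, 'a) module \<Rightarrow> 'a set \<Rightarrow> bool" where
  "generates K A V \<longleftrightarrow> (\<forall>S. assoc_subalgebra K A S \<and> V \<subseteq> S \<longrightarrow> S = carrier A)"

definition fin_dim_generating_subspace :: "'k ring \<Rightarrow> ('k, 'a) module \<Rightarrow> 'a set \<Rightarrow> bool" where
  "fin_dim_generating_subspace K A V \<longleftrightarrow> subspace K V A \<and>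
     vectorspace.fin_dim K (A\<lparr>carrier := V\<rparr>) \<and> generates K A V"

text \<open>
  Products of exactly \<open>n\<close> elements of \<open>V\<close>. The first equation makes the empty product available
  precisely in the unital case; this is why \<open>n = 1\<close> needs an equation of its own.
\<close>

fun products :: "('k, 'a) module \<Rightarrow> 'a set \<Rightarrow> nat \<Rightarrow> 'a set" where
  "products A V 0 = identities A"
| "products A V (Suc 0) = V"
| "products A V (Suc (Suc n)) = {v \<otimes>\<^bsub>A\<^esub> w | v w. v \<in> V \<and> w \<in> products A V (Suc n)}"

definition power_space :: "'k ring \<Rightarrow> ('k, 'a) module \<Rightarrow> 'a set \<Rightarrow> nat \<Rightarrow> 'a set" where
  "power_space K A V n = module.span K A (\<Union>i\<le>n. products A V i)"

definition growth_function :: "'k ring \<Rightarrow> ('k, 'a) module \<Rightarrow> 'a set \<Rightarrow> nat \<Rightarrow> nat" where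
  "growth_function K A V n = vectorspace.dim K (A\<lparr>carrier := power_space K A V n\<rparr>)"

text \<open>
  \<open>f\<close> is equivalent to the growth function of some finitely generated associative algebra \<open>A\<close> over
  some field \<open>K\<close>, where the carrier of \<open>K\<close> is a subset of the type \<open>'k\<close> and the carrier of \<open>A\<close> a
  subset of the type \<open>'a\<close>.
\<close>

definition equiv_to_algebra_growth :: "'k itself \<Rightarrow> 'a itself \<Rightarrow> (nat \<Rightarrow> nat) \<Rightarrow> bool" where
  "equiv_to_algebra_growth _ _ f \<longleftrightarrow>
     (\<exists>(K :: 'k ring) (A :: ('k, 'a) module) V.
        assoc_algebra K A \<and> fin_dim_generating_subspace K A V \<and> f \<approx> growth_function K A V)"

text \<open>
  HOL has no quantifier over types inside a formula, so an existential statement about \<open>f\<close> with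
  \<^term>\<open>\<not> equiv_to_algebra_growth TYPE('k) TYPE('a) f\<close> under the quantifier would allow \<open>f\<close> to
  depend on \<open>'k\<close> and \<open>'a\<close>. To obtain one \<open>f\<close> for all fields and algebras, the quantified part
  should mention only algebras with carriers in \<^typ>\<open>nat\<close>, complemented by the assertion, for
  arbitrary types \<open>'k\<close> and \<open>'a\<close>, that
  \<^term>\<open>equiv_to_algebra_growth TYPE('k) TYPE('a) f\<close> implies
  \<^term>\<open>equiv_to_algebra_growth TYPE(nat) TYPE(nat) f\<close>.
  The latter is true because the growth function of any finitely generated algebra is that of a
  monomial algebra over the field with two elements, which is countable.
\<close>

end

theory Submission
  imports Defs "HOL-Library.Z2" "HOL-Library.Nat_Bijection"
begin

text \<open>
  Fix generators of an algebra and order words by length and then lexicographically. The words that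
  are not linear combinations of smaller ones form a factorial language \<open>L\<close>, and the growth function
  counts the words of \<open>L\<close> of length at most \<open>n\<close>. Hence the monomial algebra of \<open>L\<close> over the field with
  two elements, which is countable, has the same growth. Moreover, the number \<open>d n\<close> of words of
  length \<open>n\<close> in \<open>L\<close> satisfies \<open>d m \<le> d n ^ j\<close> for \<open>n \<le> m \<le> j * n\<close>: if the growth is slow around \<open>n\<close>, it
  stays slow for a long time.

  The function \<open>f n = n + 2 ^ h n\<close> violates this. Here \<open>h\<close> is the supremum of the functions
  \<open>min \<lceil>n / q i\<rceil> (H i)\<close> with \<open>q i = i!\<close> and rapidly growing \<open>H i\<close>; as a supremum of subadditive
  functions it is subadditive. It is constant from \<open>q i * H i\<close> to \<open>(i + 1) * q i * H i\<close>, where \<open>f\<close>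
  grows by steps of one, and has doubled at twice the latter point, where \<open>f\<close> is at least the square
  of its value on the plateau. As \<open>g\<close> is subexponential, \<open>H i\<close> can be so large that \<open>g n \<le> 2 ^ h n\<close>
  for large \<open>n\<close>.
\<close>

section \<open>A function growing in bursts\<close>

definition ceil_div :: "nat \<Rightarrow> nat \<Rightarrow> nat" where
  "ceil_div n q = (n + (q - 1)) div q"

text \<open>Rounded-up division by \<open>q\<close> is left adjoint to multiplication by
  \<open>q\<close>. The bounds, subadditivity and monotonicity below follow from this adjunction
  without unfolding \<open>div\<close>.\<close>

lemma ceil_div_le_iff: "q \<ge> 1 \<Longrightarrow> ceil_div n q \<le> x \<longleftrightarrow> n \<le> q * x"
proof -
  assume "q \<ge> 1"
  then have "ceil_div n q \<le> x \<longleftrightarrow> ceil_div n q < Suc x" by auto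
  also have "\<dots> \<longleftrightarrow> n + (q - 1) < Suc x * q"
    unfolding ceil_div_def using \<open>q \<ge> 1\<close> by (subst div_less_iff_less_mult) auto
  also have "\<dots> \<longleftrightarrow> n \<le> q * x" using \<open>q \<ge> 1\<close> by (auto simp: algebra_simps)
  finally show ?thesis .
qed

lemma le_mult_ceil_div: "q \<ge> 1 \<Longrightarrow> n \<le> q * ceil_div n q"
  using ceil_div_le_iff[of q n "ceil_div n q"] by simp

lemma ceil_div_le_self: "q \<ge> 1 \<Longrightarrow> ceil_div n q \<le> n"
  by (simp add: ceil_div_le_iff)

lemma ceil_div_add_le: "q \<ge> 1 \<Longrightarrow> ceil_div (m + n) q \<le> ceil_div m q + ceil_div n q"
  using le_mult_ceil_div[of q m] le_mult_ceil_div[of q n] by (simp add: ceil_div_le_iff algebra_simps)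

lemma ceil_div_mono:
  assumes "q \<ge> 1" "m \<le> n" shows "ceil_div m q \<le> ceil_div n q"
  using le_mult_ceil_div[OF assms(1), of n] assms by (simp add: ceil_div_le_iff)

lemma ceil_div_antimono:
  assumes "q \<ge> 1" "q \<le> r" shows "ceil_div n r \<le> ceil_div n q"
proof -
  have "n \<le> q * ceil_div n q" using assms le_mult_ceil_div by simp
  also have "\<dots> \<le> r * ceil_div n q" using assms by simp
  finally show ?thesis using assms by (simp add: ceil_div_le_iff)
qed

text \<open>Eventually \<open>\<omega> n < 1 / q\<close>, so the exponent
  \<open>n * \<omega> n\<close> drops below \<open>n / q\<close>. The resulting threshold limits
  from below where the slope of the staircase may be lowered.\<close>

lemma subexponential_eventually_le:
  assumes "subexponential g" "q \<ge> 1"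
  shows "\<exists>N. \<forall>n\<ge>N. g n \<le> 2 ^ ceil_div n q"
proof -
  obtain w where w: "w \<longlonglongrightarrow> 0" and g: "\<And>n. n \<ge> 1 \<Longrightarrow> real (g n) \<le> 2 powr (real n * w n)"
    using assms(1) unfolding subexponential_def by blast
  have "eventually (\<lambda>n. w n < 1 / real q) sequentially"
    using w assms(2) by (intro order_tendstoD(2)) auto
  then obtain N where N: "\<And>n. n \<ge> N \<Longrightarrow> w n < 1 / real q"
    unfolding eventually_sequentially by blast
  have "g n \<le> 2 ^ ceil_div n q" if "n \<ge> max N 1" for n
  proof -
    have n: "n \<ge> N" "n \<ge> 1" using that by auto
    have "real n * w n \<le> real n * (1 / real q)"
      using N[OF n(1)] by (intro mult_left_mono) auto
    also have "\<dots> \<le> real (ceil_div n q)"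
    proof -
      have "real n \<le> real (q * ceil_div n q)" using le_mult_ceil_div[OF assms(2)] of_nat_le_iff by blast
      then show ?thesis using assms(2) by (simp add: field_simps)
    qed
    finally have "2 powr (real n * w n) \<le> 2 powr real (ceil_div n q)" by simp
    with g[OF n(2)] have "real (g n) \<le> 2 powr real (ceil_div n q)" by (rule order.trans)
    also have "\<dots> = real (2 ^ ceil_div n q)" by (simp add: powr_realpow)
    finally show ?thesis by (rule of_nat_le_iff[THEN iffD1])
  qed
  then show ?thesis by blast
qed

section \<open>The staircase exponent: slopes \<open>1 / q i\<close>, each capped at height
  \<open>H i\<close>\<close>

definition staircase :: "(nat \<Rightarrow> nat) \<Rightarrow> (nat \<Rightarrow> nat) \<Rightarrow> nat \<Rightarrow> nat" where
  "staircase q H n = (SUP i. min (ceil_div n (q i)) (H i))"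

locale staircase_function =
  fixes q H :: "nat \<Rightarrow> nat"
  assumes q_pos: "q i \<ge> 1"
begin

abbreviation h :: "nat \<Rightarrow> nat" where "h \<equiv> staircase q H"

text \<open>For fixed \<open>n\<close> all terms are at most \<open>n\<close>, so the supremum of
  infinitely many naturals is a genuine one.\<close>

lemma staircase_upper: "min (ceil_div n (q i)) (H i) \<le> h n"
  unfolding staircase_def
proof (rule cSUP_upper)
  show "bdd_above (range (\<lambda>i. min (ceil_div n (q i)) (H i)))"
    by (rule bdd_aboveI[of _ n]) (auto intro: min.coboundedI1 ceil_div_le_self q_pos)
qed simp

lemma staircase_least: "(\<And>i. min (ceil_div n (q i)) (H i) \<le> x) \<Longrightarrow> h n \<le> x"
  unfolding staircase_def by (rule cSUP_least) auto

lemma staircase_mono: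
  assumes "m \<le> n" shows "h m \<le> h n"
proof (rule staircase_least)
  fix i show "min (ceil_div m (q i)) (H i) \<le> h n"
    using staircase_upper[of n i] ceil_div_mono[OF q_pos assms, of i] by linarith
qed

lemma staircase_add_le: "h (m + n) \<le> h m + h n"
proof (rule staircase_least)
  fix i show "min (ceil_div (m + n) (q i)) (H i) \<le> h m + h n"
    using staircase_upper[of m i] staircase_upper[of n i] ceil_div_add_le[OF q_pos, of m n i] by linarith
qed

text \<open>Terms up to index \<open>i\<close> are capped by \<open>H i\<close>, and term
  \<open>i\<close> has reached its cap at \<open>q i * H i\<close>. The later terms have slope at
  most \<open>1 / q (Suc i)\<close> and cannot exceed \<open>H i\<close> before
  \<open>q (Suc i) * H i\<close>.\<close>

lemma staircase_plateau:
  assumes "mono q" "mono H" and n: "q i * H i \<le> n" "n \<le> q (Suc i) * H i"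
  shows "h n = H i"
proof (rule antisym)
  show "h n \<le> H i"
  proof (rule staircase_least)
    fix j
    show "min (ceil_div n (q j)) (H j) \<le> H i"
    proof (cases "j \<le> i")
      case True
      then show ?thesis using monoD[OF assms(2) True] by linarith
    next
      case False
      have "ceil_div n (q j) \<le> ceil_div n (q (Suc i))"
        using False by (intro ceil_div_antimono q_pos monoD[OF assms(1)]) auto
      also have "\<dots> \<le> H i" using n(2) by (simp add: ceil_div_le_iff[OF q_pos])
      finally show ?thesis by linarith
    qed
  qed
  have "q i * H i \<le> q i * ceil_div n (q i)" using n(1) le_mult_ceil_div[OF q_pos, of n i] by linarith
  then have "H i \<le> ceil_div n (q i)" using q_pos[of i] by simp
  then show "H i \<le> h n" using staircase_upper[of n i] by simp
qed

lemma staircase_after_plateau: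
  assumes "2 * H i \<le> H (Suc i)"
  shows "2 * H i \<le> h (2 * (q (Suc i) * H i))"
proof -
  let ?n = "2 * (q (Suc i) * H i)"
  have "q (Suc i) * (2 * H i) \<le> q (Suc i) * ceil_div ?n (q (Suc i))"
    using le_mult_ceil_div[OF q_pos, of ?n "Suc i"] by simp
  then have "2 * H i \<le> ceil_div ?n (q (Suc i))" using q_pos[of "Suc i"] by simp
  then show ?thesis using staircase_upper[of ?n "Suc i"] assms by linarith
qed

text \<open>The first term \<open>i\<close> with \<open>n < q i * H i\<close> is not yet capped at
  \<open>n\<close>, so \<open>h n\<close> is at least \<open>ceil_div n (q i)\<close>. Its
  predecessor \<open>j\<close> satisfies \<open>H j \<le> n\<close>, which makes \<open>dom\<close>
  applicable. The bound \<open>i \<le> H i\<close> ensures that such a term exists.\<close>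

lemma staircase_ge:
  assumes "q 0 * H 0 \<le> n" and "\<And>i. i \<le> H i"
    and dom: "\<And>i. H i \<le> n \<Longrightarrow> a \<le> 2 ^ ceil_div n (q (Suc i))"
  shows "a \<le> (2 :: nat) ^ h n"
proof -
  have "n < q (Suc n) * H (Suc n)"
    using assms(2)[of "Suc n"] q_pos[of "Suc n"]
    by (metis Suc_le_eq le_trans mult_1 mult_le_mono1)
  then obtain i where i: "n < q i * H i" "\<And>j. j < i \<Longrightarrow> \<not> n < q j * H j"
    using exists_least_iff[of "\<lambda>i. n < q i * H i"] by blast
  then obtain j where j: "i = Suc j" using assms(1) by (cases i) auto
  have "H j \<le> q j * H j" using q_pos[of j] by simp
  also have "\<dots> \<le> n" using i(2)[of j] j by simp
  finally have "a \<le> 2 ^ ceil_div n (q i)" using dom j by simp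
  moreover have "ceil_div n (q i) \<le> h n"
    using staircase_upper[of n i] i(1) by (simp add: ceil_div_le_iff[OF q_pos] min_absorb1)
  ultimately show ?thesis by (meson le_trans one_le_numeral power_increasing)
qed

definition burst :: "nat \<Rightarrow> nat" where
  "burst n = n + 2 ^ h n"

lemma positive_fun_burst: "positive_fun burst"
  by (simp add: positive_fun_def burst_def)

lemma burst_less: "m < n \<Longrightarrow> burst m < burst n"
  using staircase_mono[of m n] by (auto simp: burst_def intro!: add_less_le_mono)

lemma burst_mono: "m \<le> n \<Longrightarrow> burst m \<le> burst n"
  using burst_less[of m n] by (cases "m = n") auto

lemma increasing_burst: "increasing burst"
  by (simp add: increasing_def burst_less)

text \<open>The exponential part is submultiplicative because \<open>h\<close> is subadditive; the
  mixed terms of the product absorb the linear part \<open>n + m\<close>.\<close>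

lemma submultiplicative_burst: "submultiplicative burst"
  unfolding submultiplicative_def
proof (intro allI impI)
  fix n m :: nat assume "n \<ge> 1" "m \<ge> 1"
  have "(2::nat) ^ h (n + m) \<le> 2 ^ h n * 2 ^ h m"
    using staircase_add_le[of n m] by (metis one_le_numeral power_add power_increasing)
  moreover have "n * 1 \<le> n * 2 ^ h m" "m * 1 \<le> m * 2 ^ h n"
    by (intro mult_le_mono; simp)+
  moreover have "burst n * burst m = n * m + n * 2 ^ h m + m * 2 ^ h n + 2 ^ h n * 2 ^ h m"
    by (simp add: burst_def algebra_simps)
  moreover have "burst (n + m) = n + m + 2 ^ h (n + m)"
    by (simp add: burst_def)
  ultimately show "burst (n + m) \<le> burst n * burst m" by linarith
qed

end

text \<open>Every condition on a single \<open>H i\<close> can be met by arbitrarily large numbers,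
  so the heights can be chosen one after the other, each at least twice the preceding one.\<close>

lemma exists_staircase_heights:
  fixes K :: "nat \<Rightarrow> nat"
  assumes "\<And>i. \<exists>N. \<forall>n\<ge>N. P i n"
  shows "\<exists>H :: nat \<Rightarrow> nat. \<forall>i. (\<forall>n\<ge>H i. P i n) \<and> K i * H i \<le> 2 ^ H i \<and> 1 \<le> H i \<and>
           2 * H i \<le> H (Suc i)"
proof -
  have ex: "\<exists>x\<ge>y. (\<forall>n\<ge>x. P i n) \<and> K i * x \<le> 2 ^ x \<and> 1 \<le> x" for i y
  proof -
    obtain N where N: "\<forall>n\<ge>N. P i n" using assms by blast
    \<comment> \<open>Writing \<open>x = t + t\<close> splits \<open>2 ^ x\<close> into two factors
      \<open>2 ^ t\<close>: one dominates \<open>K i\<close>, the other dominates \<open>x\<close>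
      itself.\<close>
    define x where "x = 2 * (N + y + K i + 1)"
    have "K i * x \<le> 2 ^ x"
    proof -
      define t where "t = N + y + K i + 1"
      have "t < 2 ^ t" by simp
      have "1 \<le> t" by (simp add: t_def)
      then have "2 * t \<le> 2 ^ t" by (induction t rule: nat_induct_at_least) auto
      have "K i * x \<le> 2 ^ t * 2 ^ t"
        by (intro mult_le_mono) (use \<open>t < 2 ^ t\<close> \<open>2 * t \<le> 2 ^ t\<close> in \<open>auto simp: x_def t_def\<close>)
      moreover have "x = t + t" by (simp add: x_def t_def)
      ultimately show ?thesis by (simp add: power_add)
    qed
    then show ?thesis using N by (intro exI[of _ x]) (auto simp: x_def)
  qed
  have "\<exists>H. \<forall>i. ((\<forall>n\<ge>H i. P i n) \<and> K i * H i \<le> 2 ^ H i \<and> 1 \<le> H i) \<and> 2 * H i \<le> H (Suc i)"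
    by (rule dependent_nat_choice) (use ex in blast)+
  then show ?thesis by auto
qed

text \<open>On a plateau of \<open>f\<close>, a function equivalent to \<open>f\<close> must have a bounded increment somewhere;
  this keeps it from following the burst after the plateau.\<close>

lemma (in staircase_function) burst_not_equiv:
  assumes q: "q = fact" and H: "\<And>i. 2 * H i \<le> H (Suc i)" "\<And>i. 1 \<le> H i"
    and big: "\<And>i. Suc i * q (Suc i) * H i \<le> 2 ^ H i"
    and \<gamma>: "\<And>n. \<gamma> n = (\<Sum>m\<le>n. d m)"
    and d: "\<And>k m n. 1 \<le> n \<Longrightarrow> n \<le> m \<Longrightarrow> m \<le> k * n \<Longrightarrow> d m \<le> d n ^ k"
  shows "\<not> burst \<approx> \<gamma>"
proof
  assume "burst \<approx> \<gamma>"
  then obtain C D where CD: "C \<ge> 1" "D \<ge> 1"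
    and le: "\<And>n. n \<ge> 1 \<Longrightarrow> burst n \<le> \<gamma> (C * n)" "\<And>n. n \<ge> 1 \<Longrightarrow> \<gamma> (C * n) \<le> burst (D * n)"
    unfolding growth_equiv_def by blast
  have "mono q" unfolding q by (auto intro!: monoI fact_mono)
  have "mono H" unfolding mono_iff_le_Suc
  proof
    fix n show "H n \<le> H (Suc n)" using H(1)[of n] by linarith
  qed
  \<comment> \<open>Beyond \<open>2 * n0\<close> there will be at most \<open>2 * C * b\<close>
    increments of size at most \<open>(2 * D) ^ (4 * D)\<close>, which sum to at most
    \<open>b * (E - 1)\<close>. The summand 1 pays for the rise by \<open>b\<close> along the
    plateau.\<close>
  define E where "E = 1 + 2 * C * (2 * D) ^ (4 * D)"
  \<comment> \<open>With factorials for \<open>q\<close>, the plateau from \<open>a\<close> to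
    \<open>b\<close> has ratio \<open>b / a = Suc i\<close>. This index makes the ratio
    \<open>2 * D * E\<close>.\<close>
  define i where "i = 2 * D * E - 1"
  have "2 * D * E \<ge> 1" using CD by (simp add: E_def)
  then have i: "Suc i = 2 * D * E" by (simp add: i_def)
  define a where "a = q i * H i"
  define b where "b = q (Suc i) * H i"
  define M :: nat where "M = 2 ^ H i"
  have "a \<ge> 1" using H(2)[of i] q_pos[of i] by (simp add: a_def)
  have b: "b = 2 * D * E * a"
    unfolding a_def b_def q fact_Suc i[symmetric] by (simp add: algebra_simps)
  have "E \<ge> 1" by (simp add: E_def)
  \<comment> \<open>Both \<open>n0\<close> and \<open>2 * n0\<close> are controlled by the plateau:
    \<open>\<gamma> n0\<close> is at least \<open>burst (E * a)\<close>, and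
    \<open>\<gamma> (2 * n0)\<close> is at most
    \<open>burst (2 * D * E * a) = burst b\<close>.\<close>
  define n0 where "n0 = C * (E * a)"
  have Ea: "E * a \<ge> 1" using \<open>a \<ge> 1\<close> \<open>E \<ge> 1\<close> by simp
  have n0: "E * a \<le> n0" using CD by (simp add: n0_def)
  have "\<gamma> (2 * n0) \<le> burst b"
    using le(2)[of "2 * (E * a)"] Ea by (simp add: n0_def b algebra_simps)
  moreover have "burst b = b + M"
  proof -
    have "a \<le> b" using CD \<open>E \<ge> 1\<close> by (simp add: b)
    then show ?thesis
      using staircase_plateau[OF \<open>mono q\<close> \<open>mono H\<close>, of i b]
      by (simp add: burst_def a_def b_def M_def)
  qed
  ultimately have up: "\<gamma> (2 * n0) \<le> b + M" by simp
  have lo: "M \<le> \<gamma> n0"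
  proof -
    have "h a = H i"
      using staircase_plateau[OF \<open>mono q\<close> \<open>mono H\<close>, of i a] monoD[OF \<open>mono q\<close>, of i "Suc i"]
      by (simp add: a_def)
    then have "M \<le> burst a" by (simp add: burst_def M_def)
    also have "\<dots> \<le> burst (E * a)" using \<open>E \<ge> 1\<close> by (intro burst_mono) simp
    also have "\<dots> \<le> \<gamma> n0" unfolding n0_def by (rule le(1)[OF Ea])
    finally show ?thesis .
  qed
  have split: "\<gamma> n = \<gamma> m + sum d {m<..n}" if "m \<le> n" for m n
  proof -
    have "{..n} = {..m} \<union> {m<..n}" using that by auto
    then show ?thesis unfolding \<gamma> by (subst sum.union_disjoint[symmetric]) auto
  qed
  \<comment> \<open>By pigeonhole: the \<open>n0\<close> increments after \<open>n0\<close> sum to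
    at most \<open>b\<close>, and \<open>b \<le> 2 * D * n0\<close>.\<close>
  obtain n where n: "n0 < n" "n \<le> 2 * n0" "d n \<le> 2 * D"
  proof (rule ccontr)
    assume "\<not> thesis"
    with that have "\<not> d n \<le> 2 * D" if "n0 < n" "n \<le> 2 * n0" for n
      using that by blast
    then have *: "2 * D + 1 \<le> d n" if "n \<in> {n0<..2 * n0}" for n
      using that by (force simp: not_le Suc_le_eq)
    have "n0 * (2 * D + 1) \<le> sum d {n0<..2 * n0}"
      using sum_bounded_below[of "{n0<..2 * n0}" "2 * D + 1" d] * by simp
    also have "\<dots> \<le> b" using split[of n0 "2 * n0"] up lo by simp
    also have "\<dots> \<le> n0 * (2 * D)" using n0 by (simp add: b)
    finally show False using n0 Ea by simp
  qed
  define T where "T = (2 * D) ^ (4 * D)"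
  have n0T: "2 * n0 \<le> C * (2 * b)" "C * (2 * b) = 4 * D * n0"
    using CD by (auto simp: n0_def b)
  \<comment> \<open>The small increment at \<open>n\<close> bounds all those from
    \<open>2 * n0\<close> to \<open>4 * D * n0\<close>, since such an \<open>m\<close> lies between
    \<open>n\<close> and \<open>4 * D * n\<close>. The range reaches past the burst, up to
    \<open>C * (2 * b)\<close>.\<close>
  have "\<gamma> (C * (2 * b)) = \<gamma> (2 * n0) + sum d {2 * n0<..C * (2 * b)}"
    by (rule split) (rule n0T)
  also have "sum d {2 * n0<..C * (2 * b)} \<le> (\<Sum>m\<in>{2 * n0<..C * (2 * b)}. T)"
  proof (rule sum_mono)
    fix m assume m: "m \<in> {2 * n0<..C * (2 * b)}"
    have "m \<le> 4 * D * n0" using m n0T by auto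
    also have "\<dots> \<le> 4 * D * n" using n by simp
    finally have "d m \<le> d n ^ (4 * D)" using m n by (intro d) auto
    also have "\<dots> \<le> T" unfolding T_def by (rule power_mono) (use n in auto)
    finally show "d m \<le> T" .
  qed
  also have "\<dots> \<le> C * (2 * b) * T" by simp
  finally have "\<gamma> (C * (2 * b)) \<le> M + b * E"
    using up by (simp add: E_def T_def algebra_simps)
  moreover have "M * M \<le> \<gamma> (C * (2 * b))"
  proof -
    have "M * M \<le> 2 ^ h (2 * b)"
      using staircase_after_plateau[OF H(1), of i]
      by (simp add: M_def b_def flip: power_add mult_2)
    also have "\<dots> \<le> burst (2 * b)" by (simp add: burst_def)
    also have "\<dots> \<le> \<gamma> (C * (2 * b))" by (rule le(1)) (use b CD \<open>a \<ge> 1\<close> \<open>E \<ge> 1\<close> in simp)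
    finally show ?thesis .
  qed
  \<comment> \<open>By \<open>big\<close>, the height is so large that
    \<open>2 * E * b \<le> M\<close>. Hence \<open>b * E * M\<close> is at most half of
    \<open>M * M\<close>, and the other half dominates \<open>M\<close>.\<close>
  moreover have "M + b * E < M * M"
  proof -
    have "2 * E * b \<le> Suc i * b" using CD by (simp add: i)
    also have "\<dots> \<le> M" using big[of i] by (simp add: b_def M_def algebra_simps)
    finally have "2 * E * b * M \<le> M * M" by (rule mult_le_mono1)
    moreover have "2 * E * b * M = E * b * M + E * b * M" by simp
    moreover have "E * b \<ge> 1" using b CD \<open>a \<ge> 1\<close> \<open>E \<ge> 1\<close> by simp
    moreover have "M \<ge> 2" using H(2)[of i] self_le_power[of 2 "H i"] by (simp add: M_def)
    moreover have "M \<le> E * b * M" using \<open>E * b \<ge> 1\<close> by simp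
    moreover have "E * b < E * b * M" using \<open>E * b \<ge> 1\<close> \<open>M \<ge> 2\<close> by simp
    moreover have "b * E = E * b" by simp
    ultimately show ?thesis by linarith
  qed
  ultimately show False by simp
qed

text \<open>Algebras enter only through partial sums \<open>\<gamma>\<close> with the power bound on
  \<open>d\<close>. As \<open>f\<close> is chosen before \<open>\<gamma>\<close> and
  \<open>d\<close>, it serves all algebras at once.\<close>

lemma exists_burst_function:
  assumes "positive_fun g" "subexponential g"
  shows "\<exists>f. positive_fun f \<and> increasing f \<and> submultiplicative f \<and> g \<preceq> f \<and>
    (\<forall>\<gamma> d. (\<forall>n. \<gamma> n = (\<Sum>m\<le>n. d m)) \<longrightarrow>
       (\<forall>k m n. 1 \<le> n \<longrightarrow> n \<le> m \<longrightarrow> m \<le> k * n \<longrightarrow> d m \<le> d n ^ k) \<longrightarrow> \<not> f \<approx> \<gamma>)"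
proof -
  \<comment> \<open>The threshold for \<open>H i\<close> refers to the slope of the next term: from
    \<open>H i\<close> on, \<open>g\<close> stays below the exponential with slope
    \<open>1 / fact (Suc i)\<close>, as \<open>staircase_ge\<close> demands.\<close>
  obtain H :: "nat \<Rightarrow> nat" where
    H: "\<And>i n. n \<ge> H i \<Longrightarrow> g n \<le> 2 ^ ceil_div n (fact (Suc i))"
      "\<And>i. Suc i * fact (Suc i) * H i \<le> 2 ^ H i" "\<And>i. 1 \<le> H i" "\<And>i. 2 * H i \<le> H (Suc i)"
    using exists_staircase_heights[of "\<lambda>i n. g n \<le> 2 ^ ceil_div n (fact (Suc i))"
        "\<lambda>i. Suc i * fact (Suc i)"]
      subexponential_eventually_le[OF assms(2) fact_ge_1]
    by blast
  interpret staircase_function fact H by standard simp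
  have le_H: "i \<le> H i" for i
  proof (induction i)
    case (Suc i)
    then show ?case using H(3)[of i] H(4)[of i] by linarith
  qed simp
  have "g \<preceq> burst"
    unfolding growth_le_def
  \<comment> \<open>Below \<open>H 0\<close> the staircase need not dominate \<open>g\<close>. There
    the linear part of \<open>burst\<close> at \<open>C * n\<close> suffices, with \<open>C\<close>
    exceeding all these finitely many values of \<open>g\<close>.\<close>
  proof (intro exI[of _ "1 + (\<Sum>n<H 0. g n)"] conjI allI impI)
    let ?C = "1 + (\<Sum>n<H 0. g n)"
    fix n :: nat assume n: "n \<ge> 1"
    then have "?C * 1 \<le> ?C * n" by (intro mult_le_mono) auto
    show "g n \<le> burst (?C * n)"
    proof (cases "n < H 0")
      case True
      then have "g n \<le> (\<Sum>n<H 0. g n)" by (intro member_le_sum) auto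
      then show ?thesis using \<open>?C * 1 \<le> ?C * n\<close> by (simp add: burst_def)
    next
      case False
      then have "g n \<le> 2 ^ h n"
        by (intro staircase_ge le_H H(1)) auto
      also have "\<dots> \<le> burst n" by (simp add: burst_def)
      also have "\<dots> \<le> burst (?C * n)" by (intro burst_mono) simp
      finally show ?thesis .
    qed
  qed simp
  moreover have "\<not> burst \<approx> \<gamma>" if "\<forall>n. \<gamma> n = (\<Sum>m\<le>n. d m)"
    "\<forall>k m n. 1 \<le> n \<longrightarrow> n \<le> m \<longrightarrow> m \<le> k * n \<longrightarrow> d m \<le> d n ^ k" for \<gamma> d
    by (rule burst_not_equiv[where d = d]) (use H that in auto)
  ultimately show ?thesis
    using positive_fun_burst increasing_burst submultiplicative_burst by blast
qed

section \<open>Factorial languages\<close>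

text \<open>The empty factor is exempt because an algebra without identity has no empty
  product.\<close>

definition factorial_language :: "nat \<Rightarrow> nat list set \<Rightarrow> bool" where
  "factorial_language k L \<longleftrightarrow> (\<forall>w\<in>L. set w \<subseteq> {..<k}) \<and>
     (\<forall>u v w. u @ v @ w \<in> L \<longrightarrow> v \<noteq> [] \<longrightarrow> v \<in> L)"

lemma factorial_languageD:
  assumes "factorial_language k L"
  shows "w \<in> L \<Longrightarrow> set w \<subseteq> {..<k}"
    and "u @ v \<in> L \<Longrightarrow> u \<noteq> [] \<Longrightarrow> u \<in> L" and "u @ v \<in> L \<Longrightarrow> v \<noteq> [] \<Longrightarrow> v \<in> L"
proof -
  show "w \<in> L \<Longrightarrow> set w \<subseteq> {..<k}" using assms by (simp add: factorial_language_def)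
  show "u @ v \<in> L \<Longrightarrow> u \<noteq> [] \<Longrightarrow> u \<in> L" "u @ v \<in> L \<Longrightarrow> v \<noteq> [] \<Longrightarrow> v \<in> L"
    using assms unfolding factorial_language_def by (metis append_Nil append_Nil2)+
qed

definition level :: "'a list set \<Rightarrow> nat \<Rightarrow> 'a list set" where
  "level L n = {w \<in> L. length w = n}"

lemma finite_level: "factorial_language k L \<Longrightarrow> finite (level L n)"
  by (rule finite_subset[OF _ finite_lists_length_eq[of "{..<k}" n]])
    (auto simp: level_def dest: factorial_languageD(1))

lemma words_upto_eq_UN_level: "{w \<in> L. length w \<le> n} = (\<Union>m\<le>n. level L m)"
  by (auto simp: level_def)

lemma finite_words_upto:
  assumes "factorial_language k L" shows "finite {w \<in> L. length w \<le> n}"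
proof -
  have "finite (\<Union>m\<le>n. level L m)" using finite_level[OF assms] by blast
  then show ?thesis by (simp only: words_upto_eq_UN_level)
qed

lemma card_words_upto:
  assumes "factorial_language k L"
  shows "card {w \<in> L. length w \<le> n} = (\<Sum>m\<le>n. card (level L m))"
  unfolding words_upto_eq_UN_level
proof (rule card_UN_disjoint)
  show "\<forall>m\<in>{..n}. finite (level L m)" using finite_level[OF assms] by blast
qed (auto simp: level_def)

text \<open>A word is determined by its prefix of length \<open>n\<close> and a suffix covering the rest.\<close>

lemma card_level_le_mult:
  assumes L: "factorial_language k L" and "1 \<le> n" "n \<le> m" "1 \<le> l" "l \<le> m" "m \<le> n + l"
  shows "card (level L m) \<le> card (level L n) * card (level L l)"
proof -
  let ?f = "\<lambda>w. (take n w, drop (m - l) w)"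
  have "inj_on ?f (level L m)"
  proof (rule inj_onI)
    fix u w assume uw: "u \<in> level L m" "w \<in> level L m" "?f u = ?f w"
    have "drop n x = drop (n - (m - l)) (drop (m - l) x)" for x :: "nat list"
      using assms by simp
    then have "drop n u = drop n w" "take n u = take n w" using uw(3) by (metis prod.inject)+
    then show "u = w" by (metis append_take_drop_id)
  qed
  moreover have "?f ` level L m \<subseteq> level L n \<times> level L l"
  proof
    fix p assume "p \<in> ?f ` level L m"
    then obtain w where w: "w \<in> L" "length w = m" "p = ?f w" by (auto simp: level_def)
    have "take n w \<noteq> []" "drop (m - l) w \<noteq> []" using w assms by auto
    then show "p \<in> level L n \<times> level L l"
      using w assms factorial_languageD(2)[OF L, of "take n w" "drop n w"]
        factorial_languageD(3)[OF L, of "take (m - l) w" "drop (m - l) w"]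
      by (auto simp: level_def)
  qed
  ultimately have "card (level L m) \<le> card (level L n \<times> level L l)"
    by (intro card_inj_on_le) (auto simp: finite_level[OF L])
  then show ?thesis by (simp add: card_cartesian_product)
qed

text \<open>A word of length at most \<open>j * n\<close> is covered by \<open>j\<close> factors of
  length \<open>n\<close>; the induction splits off the prefix of length \<open>n\<close>.\<close>

lemma card_level_le_power:
  assumes L: "factorial_language k L" and "1 \<le> n" "n \<le> m" "m \<le> j * n"
  shows "card (level L m) \<le> card (level L n) ^ j"
  using assms(3,4)
proof (induction j arbitrary: m)
  case 0
  then show ?case using \<open>1 \<le> n\<close> by simp
next
  case (Suc j)
  show ?case
  proof (cases "j = 0")
    case True
    then show ?thesis using Suc.prems by simp
  next
    case False
    \<comment> \<open>The remaining suffix must have length at least \<open>n\<close> for the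
      induction hypothesis, so it is allowed to overlap the prefix.\<close>
    define l where "l = max n (m - n)"
    have "n \<le> j * n" using False by simp
    then have l: "n \<le> l" "l \<le> m" "m \<le> n + l" "l \<le> j * n"
      using Suc.prems by (auto simp: l_def)
    have "card (level L m) \<le> card (level L n) * card (level L l)"
      by (rule card_level_le_mult[OF L]) (use l Suc.prems \<open>1 \<le> n\<close> in auto)
    also have "\<dots> \<le> card (level L n) * card (level L n) ^ j"
      by (intro mult_left_mono Suc.IH l) auto
    finally show ?thesis by simp
  qed
qed

text \<open>The value of a word in base \<open>k + 1\<close> with digits \<open>1, \<dots>, k\<close>. As there is no digit \<open>0\<close>, comparing
  ranks compares words first by length and then lexicographically.\<close>

fun rank :: "nat \<Rightarrow> nat list \<Rightarrow> nat" where
  "rank k [] = 0"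
| "rank k (a # w) = Suc a * Suc k ^ length w + rank k w"

lemma rank_append: "rank k (u @ w) = rank k u * Suc k ^ length w + rank k w"
  by (induction u) (simp_all add: algebra_simps power_add)

lemma rank_less_power: "set w \<subseteq> {..<k} \<Longrightarrow> rank k w < Suc k ^ length w"
proof (induction w)
  case (Cons a w)
  then have "rank k (a # w) < Suc a * Suc k ^ length w + Suc k ^ length w" by simp
  also have "\<dots> = Suc (Suc a) * Suc k ^ length w" by simp
  also have "\<dots> \<le> Suc k * Suc k ^ length w" using Cons.prems by (intro mult_le_mono1) auto
  finally show ?case by simp
qed simp

text \<open>The leading digit of \<open>w\<close> is nonzero and already contributes
  \<open>Suc k ^ (length w - 1)\<close>, which exceeds the rank of any shorter word over the
  alphabet.\<close>

lemma rank_less_if_shorter: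
  assumes "set u \<subseteq> {..<k}" "length u < length w"
  shows "rank k u < rank k w"
proof -
  obtain a w' where w: "w = a # w'" using assms(2) by (cases w) auto
  have "rank k u < Suc k ^ length u" by (rule rank_less_power[OF assms(1)])
  also have "\<dots> \<le> Suc k ^ length w'" using assms(2) w by (intro power_increasing) auto
  also have "\<dots> \<le> rank k w" by (simp add: w)
  finally show ?thesis .
qed

lemma length_le_if_rank_less: "set w \<subseteq> {..<k} \<Longrightarrow> rank k u < rank k w \<Longrightarrow> length u \<le> length w"
  using rank_less_if_shorter[of w k u] by linarith

lemma rank_eq_imp_eq:
  assumes "length u = length w" "set u \<subseteq> {..<k}" "set w \<subseteq> {..<k}" "rank k u = rank k w"
  shows "u = w"
  using assms
proof (induction u w rule: list_induct2)
  case (Cons a u b w)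
  let ?B = "Suc k ^ length u"
  have less: "rank k u < ?B" "rank k w < ?B"
    using rank_less_power[of u k] rank_less_power[of w k] Cons by auto
  have eq: "rank k u + Suc a * ?B = rank k w + Suc b * ?B" using Cons by simp
  have "Suc a = (rank k u + Suc a * ?B) div ?B" using less by (subst div_mult_self1) auto
  also have "\<dots> = (rank k w + Suc b * ?B) div ?B" by (simp only: eq)
  also have "\<dots> = Suc b" using less by (subst div_mult_self1) auto
  finally have "a = b" by simp
  then show ?case using Cons eq by simp
qed simp

lemma inj_on_rank: "inj_on (rank k) {w. set w \<subseteq> {..<k}}"
proof (rule inj_onI)
  fix u w assume *: "u \<in> {w. set w \<subseteq> {..<k}}" "w \<in> {w. set w \<subseteq> {..<k}}" "rank k u = rank k w"
  then have "length u = length w"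
    using rank_less_if_shorter[of u k w] rank_less_if_shorter[of w k u] by force
  then show "u = w" using * rank_eq_imp_eq by blast
qed

text \<open>The order is compatible with concatenation on both sides; normal words are closed under
  factors for this reason. For a common prefix, the contribution of \<open>x\<close> grows with the
  length of what follows, hence the comparison of lengths.\<close>

lemma rank_append_less:
  assumes "set u \<subseteq> {..<k}" "rank k u < rank k w" "set w \<subseteq> {..<k}"
  shows "rank k (x @ u) < rank k (x @ w)" and "rank k (u @ x) < rank k (w @ x)"
proof -
  have "length u \<le> length w" by (rule length_le_if_rank_less) (use assms in auto)
  then have "rank k x * Suc k ^ length u \<le> rank k x * Suc k ^ length w"
    by (intro mult_left_mono power_increasing) auto
  then show "rank k (x @ u) < rank k (x @ w)"
    using assms(2) unfolding rank_append by (rule add_le_less_mono)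
  show "rank k (u @ x) < rank k (w @ x)" using assms(2) by (simp add: rank_append)
qed

section \<open>Normal words\<close>

context vectorspace
begin

lemma span_subset_subspace: "subspace K N V \<Longrightarrow> S \<subseteq> N \<Longrightarrow> span S \<subseteq> N"
  by (rule span_is_subset) auto

lemma subspaceI:
  assumes "N \<subseteq> carrier V" "\<zero>\<^bsub>V\<^esub> \<in> N"
    and "\<And>x y. x \<in> N \<Longrightarrow> y \<in> N \<Longrightarrow> x \<oplus>\<^bsub>V\<^esub> y \<in> N"
    and "\<And>c x. c \<in> carrier K \<Longrightarrow> x \<in> N \<Longrightarrow> c \<odot>\<^bsub>V\<^esub> x \<in> N"
  shows "subspace K N V"
  by (intro subspace.intro submodule.intro vectorspace_axioms module_axioms assms)

lemma dim_eq_card_basis: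
  assumes "B \<subseteq> carrier V" "finite B" "lin_indpt B"
  shows "vectorspace.dim K (vs (span B)) = card B"
proof -
  have sub: "subspace K (span B) V" using assms span_is_subspace by blast
  interpret W: vectorspace K "vs (span B)" by (rule subspace_is_vs[OF sub])
  have B: "B \<subseteq> span B" using assms in_own_span by blast
  have "W.basis B"
    unfolding W.basis_def using span_li_not_depend[OF B is_module[OF sub]] assms(3) B by simp
  then show ?thesis using W.dim_basis[OF assms(2)] by simp
qed

text \<open>Elements are added in the order of their ranks. A new one of largest rank does not
  affect earlier selections, and it is selected just when it enlarges the span, which keeps the
  selection independent. Indexing by \<open>e\<close> allows repeated vectors.\<close>

lemma greedy_basis:
  fixes e :: "'i \<Rightarrow> 'c" and r :: "'i \<Rightarrow> nat"
  assumes "finite W" "inj_on r W" "e ` W \<subseteq> carrier V"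
  defines "N \<equiv> \<lambda>W. {w \<in> W. e w \<notin> span (e ` {u \<in> W. r u < r w})}"
  shows "inj_on e (N W) \<and> lin_indpt (e ` N W) \<and> span (e ` N W) = span (e ` W)"
  using assms(1-3)
proof (induction W rule: finite_ranking_induct[where f = r])
  case empty
  show ?case by (simp add: N_def lin_dep_def)
next
  case (insert x S)
  show ?case
  proof (cases "x \<in> S")
    case True
    then show ?thesis using insert by (simp add: insert_absorb)
  next
    case False
    \<comment> \<open>The induction provides only \<open>r y \<le> r x\<close>; injectivity of
      \<open>r\<close> makes the inequality strict.\<close>
    have less: "r y < r x" if "y \<in> S" for y
      using insert.hyps(2)[OF that] insert.prems(1) that False
      by (metis inj_on_insert insert_Diff_single insert_absorb image_eqI le_neq_implies_less
          Diff_insert_absorb)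
    have IH: "inj_on e (N S)" "lin_indpt (e ` N S)" "span (e ` N S) = span (e ` S)"
      using insert by auto
    have S: "e ` S \<subseteq> carrier V" "e x \<in> carrier V" and NS: "e ` N S \<subseteq> carrier V"
      using insert.prems by (auto simp: N_def)
    have "{u \<in> insert x S. r u < r w} = {u \<in> S. r u < r w}" if "w \<in> S" for w
      using less[OF that] by auto
    moreover have "{u \<in> insert x S. r u < r x} = S" using less by auto
    ultimately have N: "N (insert x S) = N S \<union> (if e x \<in> span (e ` S) then {} else {x})"
      unfolding N_def using False by auto
    show ?thesis
    proof (cases "e x \<in> span (e ` S)")
      case True
      then show ?thesis using N IH already_in_span[OF S(1) True] by simp
    next
      case False
      have nin: "e x \<notin> e ` N S"
        using False in_own_span[OF S(1)] by (auto simp: N_def)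
      have eq: "e ` N (insert x S) = e ` N S \<union> {e x}" using N False by simp
      have "inj_on e (N (insert x S))" using N False IH(1) nin by auto
      moreover have "lin_indpt (e ` N (insert x S))"
        unfolding eq using lin_dep_iff_in_span[OF NS IH(2) S(2) nin] IH(3) False by simp
      moreover have "span (e ` N (insert x S)) = span (e ` insert x S)"
      proof
        have "e ` N (insert x S) \<subseteq> e ` insert x S" by (auto simp: N_def)
        then show "span (e ` N (insert x S)) \<subseteq> span (e ` insert x S)" by (rule span_is_monotone)
        have c: "e ` N (insert x S) \<subseteq> carrier V" using eq NS S by simp
        have "e ` S \<subseteq> span (e ` N (insert x S))"
          using in_own_span[OF S(1)] IH(3) span_is_monotone[of "e ` N S" "e ` N (insert x S)"] eq
          by auto
        moreover have "e x \<in> span (e ` N (insert x S))" using in_own_span[OF c] eq by auto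
        ultimately show "span (e ` insert x S) \<subseteq> span (e ` N (insert x S))"
          by (intro span_subset_subspace span_is_subspace c) auto
      qed
      ultimately show ?thesis by blast
    qed
  qed
qed

lemma dim_span_eq_card:
  fixes e :: "'i \<Rightarrow> 'c" and r :: "'i \<Rightarrow> nat"
  assumes "finite W" "inj_on r W" "e ` W \<subseteq> carrier V"
  shows "vectorspace.dim K (vs (span (e ` W))) =
    card {w \<in> W. e w \<notin> span (e ` {u \<in> W. r u < r w})}" (is "_ = card ?N")
proof -
  have *: "inj_on e ?N" "lin_indpt (e ` ?N)" "span (e ` ?N) = span (e ` W)"
    using greedy_basis[OF assms] by auto
  have "vectorspace.dim K (vs (span (e ` ?N))) = card (e ` ?N)"
    by (rule dim_eq_card_basis) (use assms * in auto)
  then show ?thesis using * by (simp add: card_image)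
qed

end

lemma identities_unique: "e \<in> identities A \<Longrightarrow> e' \<in> identities A \<Longrightarrow> e = e'"
  unfolding identities_def by auto

context assoc_algebra
begin

lemma alg_zero_left: "x \<in> carrier A \<Longrightarrow> \<zero> \<otimes> x = \<zero>"
  using alg_smult_l[of "\<zero>\<^bsub>K\<^esub>" "\<zero>" x] alg_m_closed[of \<zero> x] by simp

lemma alg_zero_right: "x \<in> carrier A \<Longrightarrow> x \<otimes> \<zero> = \<zero>"
  using alg_smult_r[of "\<zero>\<^bsub>K\<^esub>" x "\<zero>"] alg_m_closed[of x \<zero>] by simp

lemma subspace_preimage_mult:
  assumes N: "subspace K N A" and x: "x \<in> carrier A"
  shows "subspace K {y \<in> carrier A. x \<otimes> y \<in> N} A" "subspace K {y \<in> carrier A. y \<otimes> x \<in> N} A"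
proof -
  interpret N: submodule K N A using N by (rule is_module)
  show "subspace K {y \<in> carrier A. x \<otimes> y \<in> N} A"
    by (rule subspaceI) (auto simp: alg_zero_right x alg_r_distr alg_smult_r)
  show "subspace K {y \<in> carrier A. y \<otimes> x \<in> N} A"
    by (rule subspaceI) (auto simp: alg_zero_left x alg_l_distr alg_smult_l)
qed

text \<open>The preimage of a subspace under one-sided multiplication is a subspace, so it is enough
  to test a spanning set.\<close>

lemma mult_span_subset:
  assumes N: "subspace K N A" and x: "x \<in> carrier A" and S: "S \<subseteq> carrier A"
  shows "(\<And>y. y \<in> S \<Longrightarrow> x \<otimes> y \<in> N) \<Longrightarrow> y \<in> span S \<Longrightarrow> x \<otimes> y \<in> N"
    and "(\<And>y. y \<in> S \<Longrightarrow> y \<otimes> x \<in> N) \<Longrightarrow> y \<in> span S \<Longrightarrow> y \<otimes> x \<in> N"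
  using span_subset_subspace[OF subspace_preimage_mult(1)[OF N x], of S]
    span_subset_subspace[OF subspace_preimage_mult(2)[OF N x], of S] S by blast+

end

section \<open>Monomials in finitely many generators and the language of normal words\<close>

locale generated_algebra = assoc_algebra K A for K :: "'k ring" and A :: "('k, 'a) module" (structure) +
  fixes v :: "nat \<Rightarrow> 'a" and k :: nat
  assumes gen_closed: "i < k \<Longrightarrow> v i \<in> carrier A"
begin

text \<open>The clause for one letter avoids multiplication by an identity, which may not exist. In
  that case \<open>monomial []\<close> is an arbitrary value, and \<open>valid\<close> excludes the
  empty word.\<close>

fun monomial :: "nat list \<Rightarrow> 'a" where
  "monomial [] = (SOME e. e \<in> identities A)"
| "monomial [a] = v a"
| "monomial (a # b # w) = v a \<otimes> monomial (b # w)"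

text \<open>The empty word counts as a word only if the algebra is unital.\<close>

definition valid :: "nat list \<Rightarrow> bool" where
  "valid w \<longleftrightarrow> set w \<subseteq> {..<k} \<and> (w = [] \<longrightarrow> identities A \<noteq> {})"

text \<open>In the language of noncommutative Groebner bases, these are the words that are not
  leading words of relations between the generators.\<close>

definition normal_words :: "nat list set" where
  "normal_words = {w. valid w \<and> monomial w \<notin> span (monomial ` {u. valid u \<and> rank k u < rank k w})}"

lemma monomial_Nil: "valid [] \<Longrightarrow> monomial [] \<in> identities A"
  by (auto simp: valid_def some_in_eq)

lemma monomial_closed: "valid w \<Longrightarrow> monomial w \<in> carrier A"
proof (induction w rule: monomial.induct)
  case 1
  then show ?case using monomial_Nil by (simp add: identities_def)
qed (auto simp: valid_def gen_closed intro!: alg_m_closed)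

lemma valid_append: "valid u \<Longrightarrow> valid w \<Longrightarrow> valid (u @ w)"
  by (auto simp: valid_def)

lemma monomial_Cons: "valid [a] \<Longrightarrow> valid w \<Longrightarrow> monomial (a # w) = v a \<otimes> monomial w"
proof (cases w)
  case Nil
  assume "valid [a]" "valid w"
  then show ?thesis using Nil monomial_Nil gen_closed[of a] by (simp add: identities_def valid_def)
qed simp

lemma monomial_append:
  "valid u \<Longrightarrow> valid w \<Longrightarrow> monomial (u @ w) = monomial u \<otimes> monomial w"
proof (induction u rule: monomial.induct)
  case 1
  then show ?case using monomial_Nil monomial_closed[of w] by (simp add: identities_def)
next
  case (2 a)
  then show ?case by (simp add: monomial_Cons)
next
  case (3 a b u)
  then have *: "valid (b # u)" "valid [a]" by (auto simp: valid_def)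
  have "monomial ((a # b # u) @ w) = v a \<otimes> monomial ((b # u) @ w)" by simp
  also have "\<dots> = v a \<otimes> (monomial (b # u) \<otimes> monomial w)" using 3 * by simp
  also have "\<dots> = (v a \<otimes> monomial (b # u)) \<otimes> monomial w"
    using 3 * monomial_closed[of "[a]"] by (intro alg_m_assoc[symmetric] monomial_closed) auto
  finally show ?case by simp
qed

text \<open>Multiplying an expression of \<open>x\<close> by smaller words with \<open>u\<close>, on
  either side, expresses the longer word by smaller words, because concatenation preserves the
  order.\<close>

lemma not_normal_append:
  assumes x: "valid x" "x \<notin> normal_words" and u: "set u \<subseteq> {..<k}"
  shows "u @ x \<notin> normal_words" "x @ u \<notin> normal_words"
proof -
  let ?T = "\<lambda>w. monomial ` {u. valid u \<and> rank k u < rank k w}"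
  have T: "?T w \<subseteq> carrier A" for w using monomial_closed by auto
  have sx: "monomial x \<in> span (?T x)" using x by (simp add: normal_words_def)
  have "u @ x \<notin> normal_words \<and> x @ u \<notin> normal_words"
  \<comment> \<open>An empty \<open>u\<close> need not be \<open>valid\<close>, but it leaves
    \<open>x\<close> unchanged.\<close>
  proof (cases "u = []")
    case False
    then have vu: "valid u" using u by (simp add: valid_def)
    note c = monomial_closed[OF vu]
    have s: "subspace K (span (?T w)) A" for w by (rule span_is_subspace[OF T])
    have *: "rank k (u @ z) < rank k (u @ x)" "rank k (z @ u) < rank k (x @ u)"
      if "valid z" "rank k z < rank k x" for z
      using rank_append_less[of z k x u] that x by (auto simp: valid_def)
    have "monomial u \<otimes> monomial x \<in> span (?T (u @ x))"
    proof (rule mult_span_subset(1)[OF s c T _ sx])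
      fix y assume "y \<in> ?T x"
      then obtain z where z: "valid z" "rank k z < rank k x" "y = monomial z" by blast
      then show "monomial u \<otimes> y \<in> span (?T (u @ x))"
        using *(1)[OF z(1,2)] valid_append[OF vu z(1)] monomial_append[OF vu z(1)]
        by (intro subsetD[OF in_own_span[OF T]] image_eqI[of _ _ "u @ z"]) auto
    qed
    moreover have "monomial x \<otimes> monomial u \<in> span (?T (x @ u))"
    proof (rule mult_span_subset(2)[OF s c T _ sx])
      fix y assume "y \<in> ?T x"
      then obtain z where z: "valid z" "rank k z < rank k x" "y = monomial z" by blast
      then show "y \<otimes> monomial u \<in> span (?T (x @ u))"
        using *(2)[OF z(1,2)] valid_append[OF z(1) vu] monomial_append[OF z(1) vu]
        by (intro subsetD[OF in_own_span[OF T]] image_eqI[of _ _ "z @ u"]) auto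
    qed
    ultimately show ?thesis
      using x vu by (simp add: normal_words_def monomial_append)
  qed (use x in simp)
  then show "u @ x \<notin> normal_words" "x @ u \<notin> normal_words" by blast+
qed

lemma factorial_normal_words: "factorial_language k normal_words"
  unfolding factorial_language_def
proof (intro conjI ballI allI impI)
  fix w assume "w \<in> normal_words"
  then show "set w \<subseteq> {..<k}" by (simp add: normal_words_def valid_def)
next
  fix u x w assume *: "u @ x @ w \<in> normal_words" "x \<noteq> []"
  then have s: "set u \<subseteq> {..<k}" "set x \<subseteq> {..<k}" "set w \<subseteq> {..<k}"
    by (auto simp: normal_words_def valid_def)
  then have "valid x" "valid (x @ w)" using *(2) by (auto simp: valid_def)
  then show "x \<in> normal_words" using not_normal_append s * by blast
qed

lemma monomial_in_products: "valid w \<Longrightarrow> monomial w \<in> products A (span (v ` {..<k})) (length w)"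
proof (induction w rule: monomial.induct)
  case 1
  then show ?case using monomial_Nil by simp
next
  case (2 a)
  then show ?case using in_own_span[of "v ` {..<k}"] gen_closed by (auto simp: valid_def)
next
  case (3 a b w)
  then have "v a \<in> span (v ` {..<k})"
    using in_own_span[of "v ` {..<k}"] gen_closed by (auto simp: valid_def)
  then show ?case using 3 by (auto simp: valid_def)
qed

lemma products_subset:
  "products A (span (v ` {..<k})) n \<subseteq> span (monomial ` {w. valid w \<and> length w = n})"
proof (induction n rule: induct_nat_012)
  case 0
  have c: "monomial ` {w. valid w \<and> length w = 0} \<subseteq> carrier A" using monomial_closed by blast
  show ?case
  proof
    fix e assume e: "e \<in> products A (span (v ` {..<k})) 0"
    then have "valid []" by (auto simp: valid_def)
    then have "e = monomial []" using identities_unique monomial_Nil e by simp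
    then show "e \<in> span (monomial ` {w. valid w \<and> length w = 0})"
      using in_own_span[OF c] \<open>valid []\<close> by auto
  qed
next
  case 1
  have "v ` {..<k} \<subseteq> monomial ` {w. valid w \<and> length w = Suc 0}"
  proof
    fix x assume "x \<in> v ` {..<k}"
    then obtain a where "a < k" "x = monomial [a]" by auto
    then show "x \<in> monomial ` {w. valid w \<and> length w = Suc 0}"
      by (intro image_eqI[of _ _ "[a]"]) (auto simp: valid_def)
  qed
  then show ?case by (simp add: span_is_monotone)
next
  case (ge2 n)
  let ?M = "\<lambda>n. monomial ` {w. valid w \<and> length w = n}"
  have c: "?M n \<subseteq> carrier A" for n using monomial_closed by auto
  have g: "v ` {..<k} \<subseteq> carrier A" using gen_closed by auto
  show ?case
  proof
    fix p assume "p \<in> products A (span (v ` {..<k})) (Suc (Suc n))"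
    then obtain x y where p: "p = x \<otimes> y" "x \<in> span (v ` {..<k})"
      "y \<in> products A (span (v ` {..<k})) (Suc n)" by auto
    have y: "y \<in> span (?M (Suc n))" using ge2 p(3) by blast
    \<comment> \<open>Bilinearity is used one factor at a time: first \<open>x\<close> is reduced to
      a generator, then \<open>y\<close> to a monomial.\<close>
    have "x \<otimes> y \<in> span (?M (Suc (Suc n)))"
    proof (rule mult_span_subset(2)[OF span_is_subspace[OF c] _ g _ p(2)])
      show "y \<in> carrier A" using y span_is_subset2[OF c] by blast
      fix x assume "x \<in> v ` {..<k}"
      then obtain a where a: "a < k" "x = v a" by auto
      show "x \<otimes> y \<in> span (?M (Suc (Suc n)))"
      proof (rule mult_span_subset(1)[OF span_is_subspace[OF c] _ c _ y])
        show "x \<in> carrier A" using a gen_closed by simp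
        fix z assume "z \<in> ?M (Suc n)"
        then obtain w where w: "valid w" "length w = Suc n" "z = monomial w" by auto
        then have "x \<otimes> z = monomial (a # w)" using a by (cases w) auto
        moreover have "valid (a # w)" using w a by (auto simp: valid_def)
        ultimately show "x \<otimes> z \<in> span (?M (Suc (Suc n)))"
          using in_own_span[OF c, of "Suc (Suc n)"] w(2) by auto
      qed
    qed
    then show "p \<in> span (?M (Suc (Suc n)))" using p by simp
  qed
qed

lemma power_space_eq:
  "power_space K A (span (v ` {..<k})) n = span (monomial ` {w. valid w \<and> length w \<le> n})"
    (is "_ = span (monomial ` ?W)")
proof
  let ?V = "span (v ` {..<k})"
  have c: "monomial ` {w. valid w \<and> P w} \<subseteq> carrier A" for P using monomial_closed by auto
  have sub: "products A ?V i \<subseteq> span (monomial ` ?W)" if "i \<le> n" for i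
    by (rule subset_trans[OF products_subset span_is_monotone]) (use that in auto)
  then show "power_space K A ?V n \<subseteq> span (monomial ` ?W)"
    unfolding power_space_def by (intro span_subset_subspace span_is_subspace c) auto
  show "span (monomial ` ?W) \<subseteq> power_space K A ?V n"
    unfolding power_space_def
    by (rule span_is_monotone) (use monomial_in_products in auto)
qed

text \<open>The monomials of length at most \<open>n\<close> span the power space, and the greedy
  selection by rank keeps exactly the normal ones.\<close>

lemma growth_function_eq:
  "growth_function K A (span (v ` {..<k})) n = card {w \<in> normal_words. length w \<le> n}"
proof -
  let ?W = "{w. valid w \<and> length w \<le> n}"
  have "finite ?W"
    by (rule finite_subset[OF _ finite_lists_length_le[of "{..<k}" n]]) (auto simp: valid_def)
  moreover have "inj_on (rank k) ?W"
    by (rule inj_on_subset[OF inj_on_rank]) (auto simp: valid_def)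
  moreover have "monomial ` ?W \<subseteq> carrier A" using monomial_closed by blast
  ultimately have "growth_function K A (span (v ` {..<k})) n =
    card {w \<in> ?W. monomial w \<notin> span (monomial ` {u \<in> ?W. rank k u < rank k w})}"
    unfolding growth_function_def power_space_eq by (rule dim_span_eq_card)
  also have "{w \<in> ?W. monomial w \<notin> span (monomial ` {u \<in> ?W. rank k u < rank k w})} =
    {w \<in> normal_words. length w \<le> n}"
  proof -
    \<comment> \<open>Words of smaller rank are not longer, so restricting the length to
      \<open>n\<close> removes none of the words that \<open>w\<close> is compared with.\<close>
    have "{u \<in> ?W. rank k u < rank k w} = {u. valid u \<and> rank k u < rank k w}" if "w \<in> ?W" for w
    proof -
      have "length u \<le> n" if "rank k u < rank k w" for u
        using length_le_if_rank_less[OF _ that] \<open>w \<in> ?W\<close> by (force simp: valid_def)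
      then show ?thesis by blast
    qed
    then have "w \<in> ?W \<and> monomial w \<notin> span (monomial ` {u \<in> ?W. rank k u < rank k w}) \<longleftrightarrow>
      w \<in> normal_words \<and> length w \<le> n" for w
      unfolding normal_words_def by (cases "w \<in> ?W") (simp_all, blast+)
    then show ?thesis by blast
  qed
  finally show ?thesis .
qed

end

lemma growth_function_eq_factorial_language:
  assumes "assoc_algebra K A" "fin_dim_generating_subspace K A V"
  shows "\<exists>k L. factorial_language k L \<and>
    (\<forall>n. growth_function K A V n = card {w \<in> L. length w \<le> n})"
proof -
  interpret assoc_algebra K A by fact
  have V: "subspace K V A" "vectorspace.fin_dim K (vs V)"
    using assms(2) by (auto simp: fin_dim_generating_subspace_def)
  interpret V: vectorspace K "vs V" by (rule subspace_is_vs[OF V(1)])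
  \<comment> \<open>Any finite spanning set of \<open>V\<close> supplies the letters; linear
    dependences among them disappear on passing to normal words.\<close>
  obtain B where B: "finite B" "B \<subseteq> V" "V.span B = V" using V(2) unfolding V.fin_dim_def by auto
  then have span: "span B = V" using span_li_not_depend(1)[OF B(2) is_module[OF V(1)]] by simp
  obtain k v where kv: "B = v ` {i. i < (k :: nat)}"
    using B(1) unfolding finite_conv_nat_seg_image by blast
  have "V \<subseteq> carrier A" using V(1) by (simp add: subspace_def submodule_def)
  interpret generated_algebra K A v k
    by standard (use B(2) kv \<open>V \<subseteq> carrier A\<close> in auto)
  have "V = span (v ` {..<k})" using span kv by (simp add: lessThan_def)
  then show ?thesis using growth_function_eq factorial_normal_words by blast
qed

section \<open>Monomial algebras over the field with two elements\<close>

text \<open>Convolution on functions on words: the sum of \<open>f u * g v\<close> over all factorizations \<open>u @ v\<close>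
  of the word.\<close>

primrec conv :: "('a list \<Rightarrow> 'r) \<Rightarrow> ('a list \<Rightarrow> 'r) \<Rightarrow> 'a list \<Rightarrow> 'r::comm_ring_1" where
  "conv f g [] = f [] * g []"
| "conv f g (a # w) = f [] * g (a # w) + conv (\<lambda>u. f (a # u)) g w"

text \<open>The hypothesis compares products at factorizations of \<open>w\<close> only. Thus a
  nonzero value exhibits a factorization, and truncated products may be replaced by full ones as
  long as they agree on factors of \<open>w\<close>.\<close>

lemma conv_cong:
  "(\<And>u v. w = u @ v \<Longrightarrow> f u * g v = f' u * g' v) \<Longrightarrow> conv f g w = conv f' g' w"
proof (induction w arbitrary: f f')
  case (Cons a w)
  have "conv (\<lambda>u. f (a # u)) g w = conv (\<lambda>u. f' (a # u)) g' w"
    by (rule Cons.IH) (use Cons.prems in simp)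
  then show ?case using Cons.prems[of "[]" "a # w"] by simp
qed simp

lemma conv_zero_left: "conv (\<lambda>u. 0) g w = 0"
  by (induction w) auto

lemma conv_neq_zero: "conv f g w \<noteq> 0 \<Longrightarrow> \<exists>u v. w = u @ v \<and> f u \<noteq> 0 \<and> g v \<noteq> 0"
  using conv_cong[of w f g "\<lambda>_. 0" g] by (fastforce simp: conv_zero_left)

lemma conv_add_left: "conv (\<lambda>u. f u + f' u) g w = conv f g w + conv f' g w"
  by (induction w arbitrary: f f') (auto simp: algebra_simps)

lemma conv_add_right: "conv f (\<lambda>u. g u + g' u) w = conv f g w + conv f g' w"
  by (induction w arbitrary: f) (auto simp: algebra_simps)

lemma conv_scale_left: "conv (\<lambda>u. c * f u) g w = c * conv f g w"
  by (induction w arbitrary: f) (auto simp: algebra_simps)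

lemma conv_scale_right: "conv f (\<lambda>u. c * g u) w = c * conv f g w"
  by (induction w arbitrary: f) (auto simp: algebra_simps)

lemma conv_assoc: "conv (conv f g) h w = conv f (conv g h) w"
  by (induction w arbitrary: f)
    (auto simp: algebra_simps conv_add_left conv_scale_left)

lemma conv_of_bool_eq:
  "conv (\<lambda>x. of_bool (x = u)) (\<lambda>y. of_bool (y = v)) w = of_bool (w = u @ v)"
proof (induction w arbitrary: u)
  case (Cons a w)
  show ?case
  proof (cases u)
    case (Cons b u')
    then show ?thesis using Cons.IH[of u'] by (cases "a = b") (auto simp: conv_zero_left)
  qed (simp add: conv_zero_left)
qed auto

lemma conv_Nil_left: "conv (\<lambda>x. of_bool (x = [])) g w = g w"
  by (cases w) (auto simp: conv_zero_left)

lemma conv_Nil_right: "conv f (\<lambda>x. of_bool (x = [])) w = f w"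
  by (induction w arbitrary: f) auto

text \<open>The finite sets of words are in bijection with the natural numbers. A number is identified with
  the polynomial over the field with two elements whose monomials are the words of its set.\<close>

definition support :: "nat \<Rightarrow> nat list set" where
  "support x = list_decode ` set_decode x"

definition coefficient :: "nat \<Rightarrow> nat list \<Rightarrow> bit" where
  "coefficient x w = of_bool (w \<in> support x)"

definition combination :: "(nat list \<Rightarrow> bit) \<Rightarrow> nat" where
  "combination c = set_encode (list_encode ` {w. c w \<noteq> 0})"

lemma finite_support: "finite (support x)"
  by (simp add: support_def)

lemma coefficient_neq_zero_iff: "coefficient x w \<noteq> 0 \<longleftrightarrow> w \<in> support x"
  by (simp add: coefficient_def)

lemma coefficient_eq_zero_iff: "coefficient x w = 0 \<longleftrightarrow> w \<notin> support x"
  by (simp add: coefficient_def)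

lemma conv_coefficient_neq_zero:
  assumes "conv (coefficient x) (coefficient y) w \<noteq> 0"
  obtains u v where "w = u @ v" "u \<in> support x" "v \<in> support y"
  using conv_neq_zero[OF assms] unfolding coefficient_neq_zero_iff by blast

lemma support_combination: "finite {w. c w \<noteq> 0} \<Longrightarrow> support (combination c) = {w. c w \<noteq> 0}"
  by (simp add: support_def combination_def image_image)

lemma coefficient_combination: "finite {w. c w \<noteq> 0} \<Longrightarrow> coefficient (combination c) = c"
  by (rule ext) (simp add: coefficient_def support_combination)

lemma support_inject: "support x = support y \<Longrightarrow> x = y"
proof -
  assume *: "support x = support y"
  have "set_encode (list_encode ` support z) = z" for z by (simp add: support_def image_image)
  then show ?thesis using * by metis
qed

lemma coefficient_inject: "coefficient x = coefficient y \<Longrightarrow> x = y"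
  by (rule support_inject) (auto simp flip: coefficient_neq_zero_iff)

lemma support_zero: "support 0 = {}"
  by (simp add: support_def)

definition single :: "nat list \<Rightarrow> nat" where
  "single w = combination (\<lambda>u. of_bool (u = w))"

lemma coefficient_single: "coefficient (single w) = (\<lambda>u. of_bool (u = w))"
  unfolding single_def by (rule coefficient_combination) simp

lemma support_single: "support (single w) = {w}"
  by (auto simp: coefficient_single simp flip: coefficient_neq_zero_iff)

text \<open>The scalars are naturals, so that field and algebra both live on \<open>nat\<close>.
  Coefficients are computed in \<open>bit\<close> instead, and \<open>of_nat\<close> mediates
  between the two.\<close>

definition F2 :: "nat ring" where
  "F2 = \<lparr>carrier = {0, 1}, mult = (*), one = 1, zero = 0, add = (\<lambda>x y. (x + y) mod 2)\<rparr>"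

lemma field_F2: "field F2"
proof -
  have "cring F2"
    by (rule cringI, rule abelian_groupI, auto simp: F2_def intro!: comm_monoidI) 
  then show ?thesis
    by (rule cring.cring_fieldI) (auto simp: F2_def Units_def)
qed

text \<open>For a factorial \<open>L\<close> this is the free algebra (the one without identity if
  \<open>[] \<notin> L\<close>) modulo the ideal spanned by the words outside \<open>L\<close>.
  Elements are represented by polynomials supported in \<open>L\<close>, and the product discards
  all other words.\<close>

definition monomial_algebra :: "nat list set \<Rightarrow> (nat, nat) module" where
  "monomial_algebra L =
    \<lparr>carrier = {x. support x \<subseteq> L},
     mult = (\<lambda>x y. combination (\<lambda>w. if w \<in> L then conv (coefficient x) (coefficient y) w else 0)),
     one = single [], zero = 0,
     add = (\<lambda>x y. combination (\<lambda>w. coefficient x w + coefficient y w)),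
     smult = (\<lambda>a x. combination (\<lambda>w. of_nat a * coefficient x w))\<rparr>"

section \<open>The monomial algebra of a factorial language and its growth\<close>

context
  fixes k :: nat and L :: "nat list set" and A (structure)
  assumes L: "factorial_language k L"
  defines "A \<equiv> monomial_algebra L"
begin

lemma carrier_iff: "x \<in> carrier A \<longleftrightarrow> support x \<subseteq> L"
  by (simp add: A_def monomial_algebra_def)

lemma coefficient_zero: "coefficient \<zero> = (\<lambda>w. 0)"
  by (simp add: A_def monomial_algebra_def coefficient_def support_zero fun_eq_iff)

lemma coefficient_add: "coefficient (x \<oplus> y) = (\<lambda>w. coefficient x w + coefficient y w)"
proof -
  have "finite {w. coefficient x w + coefficient y w \<noteq> 0}"
    by (rule finite_subset[of _ "support x \<union> support y"])
      (auto simp: finite_support simp flip: coefficient_neq_zero_iff)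
  then show ?thesis by (simp add: A_def monomial_algebra_def coefficient_combination)
qed

lemma coefficient_smult: "coefficient (a \<odot> x) = (\<lambda>w. of_nat a * coefficient x w)"
proof -
  have "finite {w. of_nat a * coefficient x w \<noteq> 0}"
    by (rule finite_subset[of _ "support x"])
      (auto simp: finite_support simp flip: coefficient_neq_zero_iff)
  then show ?thesis by (simp add: A_def monomial_algebra_def coefficient_combination)
qed

lemma coefficient_mult:
  "coefficient (x \<otimes> y) = (\<lambda>w. if w \<in> L then conv (coefficient x) (coefficient y) w else 0)"
proof -
  have "{w. (if w \<in> L then conv (coefficient x) (coefficient y) w else 0) \<noteq> 0}
      \<subseteq> (\<lambda>(u, v). u @ v) ` (support x \<times> support y)"
  proof
    fix w assume "w \<in> {w. (if w \<in> L then conv (coefficient x) (coefficient y) w else 0) \<noteq> 0}"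
    then have "conv (coefficient x) (coefficient y) w \<noteq> 0" by (auto split: if_splits)
    then obtain u v where "w = u @ v" "u \<in> support x" "v \<in> support y"
      by (rule conv_coefficient_neq_zero)
    then show "w \<in> (\<lambda>(u, v). u @ v) ` (support x \<times> support y)"
      by (intro image_eqI[of _ _ "(u, v)"]) simp_all
  qed
  then have "finite {w. (if w \<in> L then conv (coefficient x) (coefficient y) w else 0) \<noteq> 0}"
    by (rule finite_subset) (simp add: finite_support)
  then show ?thesis by (simp add: A_def monomial_algebra_def coefficient_combination)
qed

lemma carrier_iff_coefficient: "x \<in> carrier A \<longleftrightarrow> (\<forall>w. w \<notin> L \<longrightarrow> coefficient x w = 0)"
  by (auto simp: carrier_iff coefficient_eq_zero_iff)

lemmas coefficient_simps = coefficient_zero coefficient_add coefficient_smult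

lemma vectorspace_monomial_algebra: "vectorspace F2 A"
proof (rule vs_criteria[OF field_F2])
  show "\<forall>x\<in>carrier A. \<exists>y\<in>carrier A. x \<oplus> y = \<zero>"
  proof
    fix x assume "x \<in> carrier A"
    \<comment> \<open>In characteristic two every element is its own negative.\<close>
    moreover have "x \<oplus> x = \<zero>" by (rule coefficient_inject) (simp add: coefficient_simps)
    ultimately show "\<exists>y\<in>carrier A. x \<oplus> y = \<zero>" by blast
  qed
next
  show "\<forall>x y. x \<in> carrier A \<and> y \<in> carrier A \<longrightarrow> x \<oplus> y = y \<oplus> x"
    by (intro allI impI coefficient_inject) (simp only: coefficient_add add.commute)
  show "\<forall>x y z. x \<in> carrier A \<and> y \<in> carrier A \<and> z \<in> carrier A \<longrightarrow>
      (x \<oplus> y) \<oplus> z = x \<oplus> (y \<oplus> z)"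
    by (intro allI impI coefficient_inject) (simp only: coefficient_add add.assoc)
qed (auto simp: carrier_iff_coefficient coefficient_simps F2_def algebra_simps
  intro!: coefficient_inject)

text \<open>Truncation is invisible at factors of words of \<open>L\<close>: nonempty ones lie in
  \<open>L\<close>, and if \<open>[] \<notin> L\<close>, then both sides vanish at the empty one.
  This yields associativity of the truncated product.\<close>

lemma coefficient_mult_factor:
  assumes "x \<in> carrier A" "y \<in> carrier A" "w \<in> L" "w = u @ v"
  shows "coefficient (x \<otimes> y) u = conv (coefficient x) (coefficient y) u"
    and "coefficient (x \<otimes> y) v = conv (coefficient x) (coefficient y) v"
proof -
  have *: "coefficient (x \<otimes> y) p = conv (coefficient x) (coefficient y) p" if "p \<in> L \<or> p = []" for p
    using that assms(1,2) by (auto simp: coefficient_mult carrier_iff_coefficient)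
  show "coefficient (x \<otimes> y) u = conv (coefficient x) (coefficient y) u"
    using factorial_languageD(2)[OF L, of u v] assms(3,4) by (intro *) auto
  show "coefficient (x \<otimes> y) v = conv (coefficient x) (coefficient y) v"
    using factorial_languageD(3)[OF L, of u v] assms(3,4) by (intro *) auto
qed

lemma assoc_algebra_monomial_algebra: "assoc_algebra F2 A"
proof (intro assoc_algebra.intro assoc_algebra_axioms.intro vectorspace_monomial_algebra)
  fix x y z assume xyz: "x \<in> carrier A" "y \<in> carrier A" "z \<in> carrier A"
  show "(x \<otimes> y) \<otimes> z = x \<otimes> (y \<otimes> z)"
  proof (rule coefficient_inject, rule ext)
    fix w
    show "coefficient ((x \<otimes> y) \<otimes> z) w = coefficient (x \<otimes> (y \<otimes> z)) w"
    proof (cases "w \<in> L")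
      case True
      have "conv (coefficient (x \<otimes> y)) (coefficient z) w =
          conv (conv (coefficient x) (coefficient y)) (coefficient z) w"
        by (rule conv_cong) (simp add: coefficient_mult_factor(1)[OF xyz(1,2) True])
      also have "\<dots> = conv (coefficient x) (conv (coefficient y) (coefficient z)) w"
        by (rule conv_assoc)
      also have "\<dots> = conv (coefficient x) (coefficient (y \<otimes> z)) w"
        by (rule conv_cong) (simp add: coefficient_mult_factor(2)[OF xyz(2,3) True])
      finally show ?thesis using True by (simp add: coefficient_mult)
    qed (simp add: coefficient_mult)
  qed
next
  fix x y z assume "x \<in> carrier A" "y \<in> carrier A" "z \<in> carrier A"
  show "(x \<oplus> y) \<otimes> z = (x \<otimes> z) \<oplus> (y \<otimes> z)"
  proof (rule coefficient_inject, rule ext)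
    show "coefficient ((x \<oplus> y) \<otimes> z) w = coefficient ((x \<otimes> z) \<oplus> (y \<otimes> z)) w" for w
      by (cases "w \<in> L")
        (simp_all only: coefficient_mult coefficient_add conv_add_left if_True if_False add_0)
  qed
  show "x \<otimes> (y \<oplus> z) = (x \<otimes> y) \<oplus> (x \<otimes> z)"
  proof (rule coefficient_inject, rule ext)
    show "coefficient (x \<otimes> (y \<oplus> z)) w = coefficient ((x \<otimes> y) \<oplus> (x \<otimes> z)) w" for w
      by (cases "w \<in> L")
        (simp_all only: coefficient_mult coefficient_add conv_add_right if_True if_False add_0)
  qed
next
  fix a x y assume "x \<in> carrier A" "y \<in> carrier A"
  show "(a \<odot> x) \<otimes> y = a \<odot> (x \<otimes> y)"
  proof (rule coefficient_inject, rule ext)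
    show "coefficient ((a \<odot> x) \<otimes> y) w = coefficient (a \<odot> (x \<otimes> y)) w" for w
      by (cases "w \<in> L")
        (simp_all only: coefficient_mult coefficient_smult conv_scale_left if_True if_False mult_zero_right)
  qed
  show "x \<otimes> (a \<odot> y) = a \<odot> (x \<otimes> y)"
  proof (rule coefficient_inject, rule ext)
    show "coefficient (x \<otimes> (a \<odot> y)) w = coefficient (a \<odot> (x \<otimes> y)) w" for w
      by (cases "w \<in> L")
        (simp_all only: coefficient_mult coefficient_smult conv_scale_right if_True if_False mult_zero_right)
  qed
qed (simp add: carrier_iff_coefficient coefficient_mult)

interpretation assoc_algebra F2 A by (rule assoc_algebra_monomial_algebra)

lemma single_closed: "w \<in> L \<Longrightarrow> single w \<in> carrier A"
  by (simp add: carrier_iff support_single)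

lemma single_mult: "u @ v \<in> L \<Longrightarrow> single u \<otimes> single v = single (u @ v)"
  by (rule coefficient_inject) (auto simp: coefficient_mult coefficient_single conv_of_bool_eq)

lemma subspace_support:
  assumes "T \<subseteq> L" shows "subspace F2 {x. support x \<subseteq> T} A"
proof -
  have "{x. support x \<subseteq> T} = {x. \<forall>w. w \<notin> T \<longrightarrow> coefficient x w = 0}"
    by (auto simp: coefficient_eq_zero_iff)
  moreover have "subspace F2 {x. \<forall>w. w \<notin> T \<longrightarrow> coefficient x w = 0} A"
  proof (rule subspaceI)
    show "{x. \<forall>w. w \<notin> T \<longrightarrow> coefficient x w = 0} \<subseteq> carrier A"
    proof
      fix x assume "x \<in> {x. \<forall>w. w \<notin> T \<longrightarrow> coefficient x w = 0}"
      then show "x \<in> carrier A" using assms unfolding carrier_iff_coefficient by blast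
    qed
  qed (auto simp: coefficient_simps)
  ultimately show ?thesis by simp
qed

text \<open>Over two elements, every \<open>x\<close> is the plain sum of \<open>single w\<close>
  for \<open>w\<close> in its support, so induction on the support applies.\<close>

lemma mem_subspace_if_singles:
  assumes N: "subspace F2 N A" and "\<And>w. w \<in> support x \<Longrightarrow> single w \<in> N"
  shows "x \<in> N"
proof -
  interpret N: submodule F2 N A using N by (rule is_module)
  have "\<forall>x. support x = S \<longrightarrow> x \<in> N" if "finite S" "\<And>w. w \<in> S \<Longrightarrow> single w \<in> N" for S
    using that
  proof (induction S)
    case empty
    have "x = \<zero>" if "support x = {}" for x
      by (rule coefficient_inject) (use that in \<open>auto simp: coefficient_zero coefficient_def\<close>)
    then show ?case using N.zero_closed by blast
  next
    case (insert w S)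
    show ?case
    proof (intro allI impI)
      fix x assume x: "support x = insert w S"
      define y where "y = combination (\<lambda>u. of_bool (u \<in> S))"
      have y: "coefficient y = (\<lambda>u. of_bool (u \<in> S))"
        unfolding y_def by (rule coefficient_combination) (simp add: insert.hyps)
      have "support y = S" by (auto simp: y simp flip: coefficient_neq_zero_iff)
      moreover have "x = single w \<oplus> y"
        by (rule coefficient_inject)
          (use x insert.hyps in \<open>auto simp: coefficient_add coefficient_single y coefficient_def\<close>)
      ultimately show "x \<in> N" using insert by simp
    qed
  qed
  then show ?thesis using finite_support assms(2) by blast
qed

lemma span_single:
  assumes "T \<subseteq> L" shows "span (single ` T) = {x. support x \<subseteq> T}"
proof
  have c: "single ` T \<subseteq> carrier A" using assms single_closed by auto
  show "span (single ` T) \<subseteq> {x. support x \<subseteq> T}"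
    by (rule span_subset_subspace[OF subspace_support[OF assms]]) (auto simp: support_single)
  show "{x. support x \<subseteq> T} \<subseteq> span (single ` T)"
  proof
    fix x assume x: "x \<in> {x. support x \<subseteq> T}"
    show "x \<in> span (single ` T)"
      by (rule mem_subspace_if_singles[OF span_is_subspace[OF c]]) (use x in_own_span[OF c] in blast)
  qed
qed

lemma single_Nil_mem_identities: "[] \<in> L \<Longrightarrow> single [] \<in> identities A"
  unfolding identities_def
proof (intro CollectI conjI ballI single_closed)
  fix x assume "[] \<in> L" "x \<in> carrier A"
  then have x: "coefficient x w = 0" if "w \<notin> L" for w
    using that unfolding carrier_iff_coefficient by blast
  show "single [] \<otimes> x = x"
    by (intro coefficient_inject ext) (simp add: coefficient_mult coefficient_single conv_Nil_left x)
  show "x \<otimes> single [] = x"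
    by (intro coefficient_inject ext) (simp add: coefficient_mult coefficient_single conv_Nil_right x)
qed

lemma identities_subset: "identities A \<subseteq> {x. support x \<subseteq> {w \<in> L. length w = 0}}"
proof (cases "[] \<in> L")
  case True
  have "identities A \<subseteq> {single []}"
  proof
    fix e assume "e \<in> identities A"
    then have "e = single []" by (rule identities_unique[OF _ single_Nil_mem_identities[OF True]])
    then show "e \<in> {single []}" by simp
  qed
  then show ?thesis using True by (auto simp: support_single)
next
  case False
  \<comment> \<open>An identity \<open>e\<close> with \<open>w\<close> in its support would satisfy
    \<open>e \<otimes> single w = single w\<close>. The coefficient at \<open>w\<close> arises only
    from \<open>w = [] @ w\<close>, which would put the empty word into the support of
    \<open>e\<close>.\<close>
  have "support e \<subseteq> {}" if e: "e \<in> identities A" for e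
  proof
    fix w assume "w \<in> support e"
    then have w: "w \<in> L" using e by (auto simp: identities_def carrier_iff)
    then have "e \<otimes> single w = single w" using e single_closed by (simp add: identities_def)
    then have "coefficient (e \<otimes> single w) w \<noteq> 0" by (simp add: coefficient_single)
    then have "conv (coefficient e) (coefficient (single w)) w \<noteq> 0"
      using w by (simp add: coefficient_mult)
    then obtain u v where "w = u @ v" "u \<in> support e" "v \<in> support (single w)"
      by (rule conv_coefficient_neq_zero)
    then have "[] \<in> L" using e by (auto simp: identities_def carrier_iff support_single)
    then show "w \<in> {}" using False by simp
  qed
  then show ?thesis by blast
qed

definition letters :: "nat set" where
  "letters = {x. support x \<subseteq> {w \<in> L. length w = 1}}"

lemma products_letters_subset: "products A letters n \<subseteq> {x. support x \<subseteq> {w \<in> L. length w = n}}"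
proof (induction n rule: induct_nat_012)
  case 0
  then show ?case using identities_subset by simp
next
  case 1
  then show ?case by (simp add: letters_def)
next
  case (ge2 n)
  show ?case
  proof
    fix p assume "p \<in> products A letters (Suc (Suc n))"
    then obtain x y where p: "p = x \<otimes> y" "x \<in> letters" "y \<in> products A letters (Suc n)" by auto
    have "w \<in> L \<and> length w = Suc (Suc n)" if "w \<in> support p" for w
    proof -
      have "coefficient (x \<otimes> y) w \<noteq> 0" using that by (simp only: p(1) coefficient_neq_zero_iff)
      then have "w \<in> L" "conv (coefficient x) (coefficient y) w \<noteq> 0"
        by (auto simp: coefficient_mult split: if_splits)
      moreover then obtain u v where "w = u @ v" "u \<in> support x" "v \<in> support y"
        by (elim conv_coefficient_neq_zero)
      moreover from this have "length u = 1" "length v = Suc n"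
        using p ge2 by (auto simp: letters_def)
      ultimately show ?thesis by simp
    qed
    then show "p \<in> {x. support x \<subseteq> {w \<in> L. length w = Suc (Suc n)}}" by blast
  qed
qed

lemma single_in_products: "w \<in> L \<Longrightarrow> single w \<in> products A letters (length w)"
proof (induction w rule: induct_list012)
  case 1
  then show ?case by (simp add: single_Nil_mem_identities)
next
  case (2 a)
  then show ?case by (simp add: letters_def support_single)
next
  case (3 a b w)
  then have "[a] \<in> L" "b # w \<in> L"
    using factorial_languageD(2,3)[OF L, of "[a]" "b # w"] by auto
  then have "single [a] \<in> letters" "single (b # w) \<in> products A letters (Suc (length w))"
    using 3 by (auto simp: letters_def support_single)
  moreover have "single (a # b # w) = single [a] \<otimes> single (b # w)"
    using single_mult[of "[a]" "b # w"] 3 by simp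
  ultimately show ?case by auto
qed

lemma power_space_letters:
  "power_space F2 A letters n = {x. support x \<subseteq> {w \<in> L. length w \<le> n}}"
proof
  let ?P = "\<Union>i\<le>n. products A letters i"
  have P: "?P \<subseteq> {x. support x \<subseteq> {w \<in> L. length w \<le> n}}"
    using products_letters_subset by fastforce
  have s: "subspace F2 {x. support x \<subseteq> {w \<in> L. length w \<le> n}} A"
    by (rule subspace_support) auto
  show "power_space F2 A letters n \<subseteq> {x. support x \<subseteq> {w \<in> L. length w \<le> n}}"
    unfolding power_space_def by (rule span_subset_subspace[OF s P])
  have c: "?P \<subseteq> carrier A"
  proof
    fix x assume "x \<in> ?P"
    then have "support x \<subseteq> {w \<in> L. length w \<le> n}" using P by blast
    then show "x \<in> carrier A" by (auto simp: carrier_iff)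
  qed
  show "{x. support x \<subseteq> {w \<in> L. length w \<le> n}} \<subseteq> power_space F2 A letters n"
  proof
    fix x assume x: "x \<in> {x. support x \<subseteq> {w \<in> L. length w \<le> n}}"
    show "x \<in> power_space F2 A letters n"
      unfolding power_space_def
    proof (rule mem_subspace_if_singles[OF span_is_subspace[OF c]])
      fix w assume "w \<in> support x"
      then have "w \<in> L" "length w \<le> n" using x by auto
      then show "single w \<in> span ?P" using single_in_products in_own_span[OF c] by blast
    qed
  qed
qed

text \<open>Distinct words are linearly independent, so the greedy selection discards none of them;
  here \<open>rank\<close> serves as an injective ranking.\<close>

lemma growth_function_letters: "growth_function F2 A letters n = card {w \<in> L. length w \<le> n}"
proof -
  let ?T = "{w \<in> L. length w \<le> n}"
  have "growth_function F2 A letters n = vectorspace.dim F2 (vs (span (single ` ?T)))"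
    unfolding growth_function_def power_space_letters by (subst span_single) auto
  also have "\<dots> = card {w \<in> ?T. single w \<notin> span (single ` {u \<in> ?T. rank k u < rank k w})}"
  proof (rule dim_span_eq_card)
    show "inj_on (rank k) ?T"
      by (rule inj_on_subset[OF inj_on_rank]) (use factorial_languageD(1)[OF L] in blast)
  qed (auto simp: finite_words_upto[OF L] single_closed)
  also have "{w \<in> ?T. single w \<notin> span (single ` {u \<in> ?T. rank k u < rank k w})} = ?T"
    by (subst span_single) (auto simp: support_single)
  finally show ?thesis .
qed

lemma fin_dim_generating_letters: "fin_dim_generating_subspace F2 A letters"
  unfolding fin_dim_generating_subspace_def
proof (intro conjI)
  show sub: "subspace F2 letters A"
    unfolding letters_def by (rule subspace_support) auto
  interpret W: vectorspace F2 "vs letters" by (rule subspace_is_vs[OF sub])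
  let ?B = "single ` {w \<in> L. length w = 1}"
  have B: "?B \<subseteq> letters" by (auto simp: letters_def support_single)
  have "finite {w \<in> L. length w = 1}" using finite_level[OF L, of 1] by (simp add: level_def)
  moreover have "W.span ?B = letters"
    using span_li_not_depend(1)[OF B is_module[OF sub]] span_single[of "{w \<in> L. length w = 1}"]
    by (auto simp: letters_def)
  ultimately show "W.fin_dim" unfolding W.fin_dim_def using B by (intro exI[of _ ?B]) auto
  show "generates F2 A letters"
    unfolding generates_def
  proof (intro allI impI)
    fix S assume "assoc_subalgebra F2 A S \<and> letters \<subseteq> S"
    then have S: "subspace F2 S A" "identities A \<subseteq> S" "letters \<subseteq> S"
      "\<And>x y. x \<in> S \<Longrightarrow> y \<in> S \<Longrightarrow> x \<otimes> y \<in> S"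
      by (auto simp: assoc_subalgebra_def)
    have "products A letters n \<subseteq> S" for n
    proof (induction n rule: induct_nat_012)
      case (ge2 n)
      show ?case
      proof
        fix p assume "p \<in> products A letters (Suc (Suc n))"
        then obtain x y where "p = x \<otimes> y" "x \<in> letters" "y \<in> products A letters (Suc n)" by auto
        then show "p \<in> S" using S(3,4) ge2 by blast
      qed
    qed (use S in simp_all)
    then have "single w \<in> S" if "w \<in> L" for w using single_in_products[OF that] by blast
    then have "x \<in> S" if "x \<in> carrier A" for x
      using that mem_subspace_if_singles[OF S(1), of x] unfolding carrier_iff by blast
    moreover have "S \<subseteq> carrier A" using S(1) by (simp add: subspace_def submodule_def)
    ultimately show "S = carrier A" by blast
  qed
qed

end

section \<open>Transfer to countable carriers, and the conclusion\<close>

lemma equiv_to_algebra_growth_nat: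
  assumes "equiv_to_algebra_growth TYPE('k) TYPE('a) f"
  shows "equiv_to_algebra_growth TYPE(nat) TYPE(nat) f"
proof -
  obtain K :: "'k ring" and A :: "('k, 'a) module" and V where
    A: "assoc_algebra K A" "fin_dim_generating_subspace K A V" and f: "f \<approx> growth_function K A V"
    using assms unfolding equiv_to_algebra_growth_def by blast
  obtain k L where L: "factorial_language k L"
    and eq: "\<And>n. growth_function K A V n = card {w \<in> L. length w \<le> n}"
    using growth_function_eq_factorial_language[OF A] by blast
  \<comment> \<open>The two growth functions are equal, not merely equivalent: both count the normal
    words of length at most \<open>n\<close>.\<close>
  have "growth_function K A V = growth_function F2 (monomial_algebra L) (letters L)"
    by (rule ext) (simp add: eq growth_function_letters[OF L])
  then show ?thesis
    unfolding equiv_to_algebra_growth_def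
    using f assoc_algebra_monomial_algebra[OF L] fin_dim_generating_letters[OF L] by metis
qed

theorem theorem1p4:
  fixes g :: "nat \<Rightarrow> nat"
  assumes "positive_fun g" and "subexponential g"
  shows "(\<exists>f. positive_fun f \<and> increasing f \<and> submultiplicative f \<and> g \<preceq> f \<and>
              \<not> equiv_to_algebra_growth TYPE(nat) TYPE(nat) f) \<and>
         (\<forall>f. equiv_to_algebra_growth TYPE('k) TYPE('a) f \<longrightarrow>
              equiv_to_algebra_growth TYPE(nat) TYPE(nat) f)"
proof (intro conjI allI impI)
  obtain f where f: "positive_fun f" "increasing f" "submultiplicative f" "g \<preceq> f"
    and not_equiv: "\<And>\<gamma> d. \<forall>n. \<gamma> n = (\<Sum>m\<le>n. d m) \<Longrightarrow>
      \<forall>j m n. 1 \<le> n \<longrightarrow> n \<le> m \<longrightarrow> m \<le> j * n \<longrightarrow> d m \<le> d n ^ j \<Longrightarrow> \<not> f \<approx> \<gamma>"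
    using exists_burst_function[OF assms] by blast
  have "\<not> equiv_to_algebra_growth TYPE(nat) TYPE(nat) f"
  proof
    assume "equiv_to_algebra_growth TYPE(nat) TYPE(nat) f"
    then obtain K :: "nat ring" and A :: "(nat, nat) module" and V where
      A: "assoc_algebra K A" "fin_dim_generating_subspace K A V"
      and equiv: "f \<approx> growth_function K A V"
      unfolding equiv_to_algebra_growth_def by blast
    obtain k L where L: "factorial_language k L"
      and growth: "\<And>n. growth_function K A V n = card {w \<in> L. length w \<le> n}"
      using growth_function_eq_factorial_language[OF A] by blast
    \<comment> \<open>The increments of the growth function are the sizes of the levels of
      \<open>L\<close>, which satisfy the power bound.\<close>
    have "\<not> f \<approx> growth_function K A V"
      by (rule not_equiv[of _ "\<lambda>n. card (level L n)"])
        (simp_all add: growth card_words_upto[OF L] card_level_le_power[OF L])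
    then show False using equiv by blast
  qed
  then show "\<exists>f. positive_fun f \<and> increasing f \<and> submultiplicative f \<and> g \<preceq> f \<and>
      \<not> equiv_to_algebra_growth TYPE(nat) TYPE(nat) f"
    using f by blast
next
  fix f
  assume "equiv_to_algebra_growth TYPE('k) TYPE('a) f"
  then show "equiv_to_algebra_growth TYPE(nat) TYPE(nat) f"
    by (rule equiv_to_algebra_growth_nat)
qed

end
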